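(* Let $M_\kappa$ be the 2-dimensional model space with constant sectional curvature $\kappa\in\mathbb R$. Then: \begin{itemize} \item If $\kappa>0$, $D^{\mathrm{VR}}_{4,1}(M_\kappa)=\left\{(t_b,t_d):\ \sin\left(\frac{\sqrt\kappa}{2}t_d\right)\le\sqrt2\,\sin\left(\frac{\sqrt\kappa}{2}t_b\right)\text{ and }0<t_b<t_d\le\frac{\pi}{\sqrt\kappa}\right\}$. \item If $\kappa=0$, $D^{\mathrm{VR}}_{4,1}(M_0)=\left\{(t_b,t_d):\ 0\le t_b<t_d\le\sqrt2\,t_b\right\}$. \item If $\kappa<0$, $D^{\mathrm{VR}}_{4,1}(M_\kappa)=\left\{(t_b,t_d):\ \sinh\left(\frac{\sqrt{-\kappa}}{2}t_d\right)\le\sqrt2\,\sinh\left(\frac{\sqrt{-\kappa}}{2}t_b\right)\text{ and }0<t_b<t_d\right\}$. \end{itemize}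
   Context: $M_0=\mathbb R^2$ with the Euclidean metric. For $\kappa>0$, $M_\kappa=\{x\in\mathbb R^3:\langle x,x\rangle=1/\kappa\}$ (sphere of radius $1/\sqrt\kappa$) with geodesic distance $d(x,y)=\frac1{\sqrt\kappa}\arccos(\kappa\langle x,y\rangle)$, where $\langle x,y\rangle=x_1y_1+x_2y_2+x_3y_3$. For $\kappa<0$, $M_\kappa=\{x\in\mathbb R^3:\langle x|x\rangle=1/\kappa,\ x_1>0\}$ (rescaled hyperbolic plane) with $d(x,y)=\frac1{\sqrt{-\kappa}}\operatorname{arccosh}(\kappa\langle x|y\rangle)$, where $\langle x|y\rangle=-x_1y_1+x_2y_2+x_3y_3$. For a finite metric space $Y$ and $r\ge 0$, $\mathrm{VR}_r(Y)$ is the simplicial complex of nonempty subsets $\sigma\subset Y$ with $\mathrm{diam}(\sigma)\le r$. With a fixed coefficient field $\mathbb F$, the persistence module $r\mapsto\widetilde H_1(\mathrm{VR}_r(Y);\mathbb F)$ decomposes into finitely many interval modules on intervals $[b_\alpha,d_\alpha)$, and $\mathrm{dgm}_1^{\mathrm{VR}}(Y)$ is the multiset of points $(b_\alpha,d_\alpha)$. If $|Y|\le 4$ this diagram has at most one point. For a metric space $X$, $D^{\mathrm{VR}}_{4,1}(X)$ is identified with the subset of $\mathbb R^2$ of all $(t_b,t_d)$ such that $\mathrm{dgm}_1^{\mathrm{VR}}(X')=\{(t_b,t_d)\}$ for some $X'\subset X$ with $|X'|\le 4$ (the empty diagram is omitted by convention). *)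

theory Defs
  imports
    "HOL-Analysis.Analysis"
    "HOL-Library.Function_Algebras"
    "HOL-Library.Set_Algebras"
    "HOL-Library.Multiset"
begin

section \<open>Model spaces\<close>

text \<open>
  A metric space is given by a carrier set together with a distance function.
  The plane is \<^term>\<open>UNIV :: (real^2) set\<close> with the library distance \<^const>\<open>dist\<close>.
\<close>

definition sphere_space :: "real \<Rightarrow> (real^3) set" where
  "sphere_space \<kappa> = {x. x \<bullet> x = 1 / \<kappa>}"

definition sphere_dist :: "real \<Rightarrow> real^3 \<Rightarrow> real^3 \<Rightarrow> real" where
  "sphere_dist \<kappa> x y = 1 / sqrt \<kappa> * arccos (\<kappa> * (x \<bullet> y))"

definition lorentz :: "real^3 \<Rightarrow> real^3 \<Rightarrow> real" where
  "lorentz x y = - (x $ 1 * y $ 1) + x $ 2 * y $ 2 + x $ 3 * y $ 3"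

definition hyp_space :: "real \<Rightarrow> (real^3) set" where
  "hyp_space \<kappa> = {x. lorentz x x = 1 / \<kappa> \<and> x $ 1 > 0}"

definition hyp_dist :: "real \<Rightarrow> real^3 \<Rightarrow> real^3 \<Rightarrow> real" where
  "hyp_dist \<kappa> x y = 1 / sqrt (- \<kappa>) * arcosh (\<kappa> * lorentz x y)"

section \<open>Vietoris-Rips complexes\<close>

definition set_diam :: "('a \<Rightarrow> 'a \<Rightarrow> real) \<Rightarrow> 'a set \<Rightarrow> real" where
  "set_diam d \<sigma> = (SUP (x, y) \<in> \<sigma> \<times> \<sigma>. d x y)"

definition VR :: "('a \<Rightarrow> 'a \<Rightarrow> real) \<Rightarrow> 'a set \<Rightarrow> real \<Rightarrow> 'a set set" where
  "VR d Y r = {\<sigma>. \<sigma> \<noteq> {} \<and> \<sigma> \<subseteq> Y \<and> set_diam d \<sigma> \<le> r}"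

section \<open>Reduced simplicial homology of a finite complex over a field\<close>

text \<open>
  An oriented \<open>n\<close>-chain is a function \<open>c\<close> on ordered \<open>n\<close>-simplices (lists of \<open>n + 1\<close> distinct
  vertices spanning a simplex) that changes sign under transpositions of the vertices.
  The list \<open>[v\<^sub>0, \<dots>, v\<^sub>n]\<close> stands for the oriented simplex, and \<open>c [v\<^sub>0, \<dots>, v\<^sub>n]\<close> is
  its coefficient.  Adjacent transpositions generate all permutations.
\<close>

definition chains :: "'a set set \<Rightarrow> nat \<Rightarrow> ('a list \<Rightarrow> 'f::field) set" where
  "chains K n = {c.
     (\<forall>vs. c vs \<noteq> 0 \<longrightarrow> length vs = n + 1 \<and> distinct vs \<and> set vs \<in> K) \<and>
     (\<forall>us x y ws. c (us @ [x, y] @ ws) = - c (us @ [y, x] @ ws))}"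

text \<open>
  This is \<open>\<partial>[v\<^sub>0, \<dots>, v\<^sub>n] = (\<Sum>i. (-1)^i [v\<^sub>0, \<dots>, v\<^sub>i omitted, \<dots>, v\<^sub>n])\<close> read on coefficients:
  the simplices having \<open>ws\<close> as the oriented face opposite to their first vertex are the
  \<open>x # ws\<close>, and moving \<open>v\<^sub>i\<close> to the front of \<open>[v\<^sub>0, \<dots>, v\<^sub>n]\<close> costs the sign \<open>(-1)^i\<close>.
  For \<open>n = 0\<close> the value at the empty list is the augmentation \<open>\<Sum>x. c [x]\<close>, so that the
  homology below is reduced.
\<close>

definition boundary :: "'a set set \<Rightarrow> ('a list \<Rightarrow> 'f::field) \<Rightarrow> 'a list \<Rightarrow> 'f" where
  "boundary K c = (\<lambda>ws. \<Sum>x\<in>\<Union>K. c (x # ws))"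

definition cycles :: "'a set set \<Rightarrow> nat \<Rightarrow> ('a list \<Rightarrow> 'f::field) set" where
  "cycles K n = {c \<in> chains K n. boundary K c = 0}"

definition boundaries :: "'a set set \<Rightarrow> nat \<Rightarrow> ('a list \<Rightarrow> 'f::field) set" where
  "boundaries K n = boundary K ` chains K (Suc n)"

text \<open>Homology classes are the cosets \<open>z + B\<^sub>n\<close> of cycles \<open>z\<close>.\<close>

definition homology_classes :: "'a set set \<Rightarrow> nat \<Rightarrow> ('a list \<Rightarrow> 'f::field) set set" where
  "homology_classes K n = (\<lambda>z. z +o boundaries K n) ` cycles K n"

section \<open>Persistence modules and diagrams\<close>

text \<open>
  A persistence module indexed by the reals \<open>r \<ge> 0\<close>: vector spaces with carriers \<open>pspace V r\<close>,
  addition and scalar multiplication, and structure maps \<open>pmap V r s\<close> for \<open>r \<le> s\<close>.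
  Indices \<open>r < 0\<close> and structure maps with \<open>r > s\<close> are ignored.
\<close>

record ('f, 'v) pmodule =
  pspace :: "real \<Rightarrow> 'v set"
  padd :: "real \<Rightarrow> 'v \<Rightarrow> 'v \<Rightarrow> 'v"
  psmult :: "real \<Rightarrow> 'f \<Rightarrow> 'v \<Rightarrow> 'v"
  pmap :: "real \<Rightarrow> real \<Rightarrow> 'v \<Rightarrow> 'v"

definition pmodule_iso :: "('f, 'v) pmodule \<Rightarrow> ('f, 'w) pmodule \<Rightarrow> bool" where
  "pmodule_iso V W \<longleftrightarrow> (\<exists>\<phi>.
     (\<forall>r\<ge>0. bij_betw (\<phi> r) (pspace V r) (pspace W r)) \<and>
     (\<forall>r\<ge>0. \<forall>u\<in>pspace V r. \<forall>v\<in>pspace V r. \<phi> r (padd V r u v) = padd W r (\<phi> r u) (\<phi> r v)) \<and>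
     (\<forall>r\<ge>0. \<forall>a. \<forall>v\<in>pspace V r. \<phi> r (psmult V r a v) = psmult W r a (\<phi> r v)) \<and>
     (\<forall>r\<ge>0. \<forall>s\<ge>r. \<forall>v\<in>pspace V r. \<phi> s (pmap V r s v) = pmap W r s (\<phi> r v)))"

text \<open>
  The direct sum of the interval modules on \<open>[b\<^sub>i, d\<^sub>i)\<close>, where \<open>(b\<^sub>i, d\<^sub>i) = ps ! i\<close>; the
  \<open>i\<close>-th coordinate of an element of the sum lies in the \<open>i\<close>-th summand.
\<close>

definition interval_sum :: "(real \<times> real) list \<Rightarrow> ('f::field, nat \<Rightarrow> 'f) pmodule" where
  "interval_sum ps =
     \<lparr> pspace = (\<lambda>r. {x. \<forall>i. x i \<noteq> 0 \<longrightarrow> i < length ps \<and> r \<in> {fst (ps ! i)..<snd (ps ! i)}}),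
       padd = (\<lambda>r x y. x + y),
       psmult = (\<lambda>r a x i. a * x i),
       pmap = (\<lambda>r s x i.
         if i < length ps \<and> r \<in> {fst (ps ! i)..<snd (ps ! i)} \<and> s \<in> {fst (ps ! i)..<snd (ps ! i)}
         then x i else 0) \<rparr>"

text \<open>
  Only nonempty intervals contained in the index set count, so that the multiset is
  determined by the module.
\<close>

definition has_diagram :: "('f::field, 'v) pmodule \<Rightarrow> (real \<times> real) multiset \<Rightarrow> bool" where
  "has_diagram V D \<longleftrightarrow>
     (\<exists>ps. mset ps = D \<and> (\<forall>(b, d)\<in>set ps. 0 \<le> b \<and> b < d) \<and> pmodule_iso V (interval_sum ps))"

text \<open>
  Operations on cosets: \<open>+\<close> is the elementwise sum of sets, i.e. \<open>(z + B) + (z' + B) = (z + z') + B\<close>.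
  Adding \<open>B\<close> after scaling is needed for the scalar 0.  The structure map induced by
  inclusion sends \<open>z + B\<^sub>r\<close> to \<open>z + B\<^sub>s = (z + B\<^sub>r) + B\<^sub>s\<close>, as \<open>B\<^sub>r \<subseteq> B\<^sub>s\<close>.
\<close>

definition VR_module ::
    "nat \<Rightarrow> ('a \<Rightarrow> 'a \<Rightarrow> real) \<Rightarrow> 'a set \<Rightarrow> ('f::field, ('a list \<Rightarrow> 'f) set) pmodule" where
  "VR_module k d Y =
     \<lparr> pspace = (\<lambda>r. homology_classes (VR d Y r) k),
       padd = (\<lambda>r A A'. A + A'),
       psmult = (\<lambda>r a A. (\<lambda>z vs. a * z vs) ` A + boundaries (VR d Y r) k),
       pmap = (\<lambda>r s A. A + boundaries (VR d Y s) k) \<rparr>"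

text \<open>The type argument is the coefficient field.\<close>

definition dgm_VR ::
    "'f::field itself \<Rightarrow> nat \<Rightarrow> ('a \<Rightarrow> 'a \<Rightarrow> real) \<Rightarrow> 'a set \<Rightarrow> (real \<times> real) multiset \<Rightarrow> bool" where
  "dgm_VR F k d Y D \<longleftrightarrow> has_diagram (VR_module k d Y :: ('f, ('a list \<Rightarrow> 'f) set) pmodule) D"

definition persistence_set ::
    "'f::field itself \<Rightarrow> nat \<Rightarrow> nat \<Rightarrow> 'a set \<Rightarrow> ('a \<Rightarrow> 'a \<Rightarrow> real) \<Rightarrow> (real \<times> real) multiset set" where
  "persistence_set F n k X d = {D. \<exists>X'\<subseteq>X. finite X' \<and> card X' \<le> n \<and> dgm_VR F k d X' D}"

text \<open>One-point diagrams identified with points of the plane, the empty diagram being omitted.\<close>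

definition D_VR_4_1 ::
    "'f::field itself \<Rightarrow> 'a set \<Rightarrow> ('a \<Rightarrow> 'a \<Rightarrow> real) \<Rightarrow> (real \<times> real) set" where
  "D_VR_4_1 F X d = {(t\<^sub>b, t\<^sub>d). {#(t\<^sub>b, t\<^sub>d)#} \<in> persistence_set F 4 1 X d}"

end

theory Submission
  imports Defs
begin

text \<open>
  A Vietoris-Rips complex is a flag complex.  On at most four vertices its first homology vanishes
  unless the 1-skeleton is a 4-cycle: in all other cases some vertex is isolated or dominated by a neighbour,
  and a cycle can be pushed off it.  So the diagram is empty unless the points can be labelled
  \<open>a, b, c, e\<close> with the longest side of this quadrilateral shorter than its shorter diagonal, and then
  these two lengths are birth and death.

  For the geometric inequality put \<open>p = a + c\<close> and \<open>q = b + e\<close> in the ambient space.  The forms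
  \<open>\<langle>p, p\<rangle>\<close> and \<open>\<langle>q, q\<rangle>\<close> involve only the diagonals, \<open>\<langle>p, q\<rangle>\<close> only the sides, and the two are
  compared by \<open>\<langle>p - q, p - q\<rangle> \<ge> 0\<close>, or for the Lorentz form by the reverse Cauchy-Schwarz inequality.
  Conversely, take two diagonals of length \<open>t\<close> with a common midpoint.  As the angle between them
  varies, the longer side takes all values from that of the square up to \<open>t\<close>, excluded.
\<close>

section \<open>Vietoris-Rips complexes and chains\<close>

text \<open>A real supremum behaves as a maximum only over a nonempty bounded family; finiteness of
  \<open>Y\<close> supplies the bound. Simplices are then decided pairwise, which is the flag
  property.\<close>

lemma mem_VR:
  assumes "finite Y"
  shows "\<sigma> \<in> VR d Y r \<longleftrightarrow> \<sigma> \<noteq> {} \<and> \<sigma> \<subseteq> Y \<and> (\<forall>x\<in>\<sigma>. \<forall>y\<in>\<sigma>. d x y \<le> r)"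
proof (cases "\<sigma> \<noteq> {} \<and> \<sigma> \<subseteq> Y")
  case True
  then have fin: "finite (\<sigma> \<times> \<sigma>)" using assms finite_subset by blast
  have "set_diam d \<sigma> \<le> r \<longleftrightarrow> (\<forall>p\<in>\<sigma>\<times>\<sigma>. (case p of (x, y) \<Rightarrow> d x y) \<le> r)"
    unfolding set_diam_def
    by (rule cSUP_le_iff) (use True fin in \<open>auto intro!: bdd_above_finite\<close>)
  then show ?thesis using True by (auto simp: VR_def)
next
  case False
  then show ?thesis by (auto simp: VR_def)
qed

section \<open>Group structure of chains and boundaries, and cosets\<close>

lemma chains_zero: "(0 :: 'a list \<Rightarrow> 'f::field) \<in> chains K n"
  by (auto simp: chains_def)

lemma chains_add:
  fixes c c' :: "'a list \<Rightarrow> 'f::field"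
  assumes "c \<in> chains K n" "c' \<in> chains K n"
  shows "c + c' \<in> chains K n"
  unfolding chains_def mem_Collect_eq
proof (intro conjI allI impI)
  fix vs assume "(c + c') vs \<noteq> 0"
  then have "c vs \<noteq> 0 \<or> c' vs \<noteq> 0" by auto
  then show "length vs = n + 1" "distinct vs" "set vs \<in> K"
    using assms unfolding chains_def by blast+
next
  fix us ws :: "'a list" and x y
  have "c (us @ [x, y] @ ws) = - c (us @ [y, x] @ ws)" "c' (us @ [x, y] @ ws) = - c' (us @ [y, x] @ ws)"
    using assms unfolding chains_def by blast+
  then show "(c + c') (us @ [x, y] @ ws) = - (c + c') (us @ [y, x] @ ws)"
    by (simp only: plus_fun_apply minus_add_distrib)
qed

lemma chains_uminus:
  fixes c :: "'a list \<Rightarrow> 'f::field"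
  assumes "c \<in> chains K n"
  shows "- c \<in> chains K n"
  using assms unfolding chains_def mem_Collect_eq uminus_apply neg_equal_iff_equal neg_equal_0_iff_equal .

lemma boundary_add:
  fixes c c' :: "'a list \<Rightarrow> 'f::field"
  shows "boundary K (c + c') = boundary K c + boundary K c'"
  by (simp add: boundary_def fun_eq_iff sum.distrib)

lemma boundary_uminus:
  fixes c :: "'a list \<Rightarrow> 'f::field"
  shows "boundary K (- c) = - boundary K c"
  by (simp add: boundary_def fun_eq_iff sum_negf)

lemma boundary_zero: "boundary K (0 :: 'a list \<Rightarrow> 'f::field) = 0"
  by (simp add: boundary_def fun_eq_iff)

lemma boundaries_zero: "(0 :: 'a list \<Rightarrow> 'f::field) \<in> boundaries K n"
  unfolding boundaries_def using boundary_zero chains_zero by (metis image_eqI)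

lemma boundaries_add:
  fixes b b' :: "'a list \<Rightarrow> 'f::field"
  assumes "b \<in> boundaries K n" "b' \<in> boundaries K n"
  shows "b + b' \<in> boundaries K n"
proof -
  obtain c c' where "c \<in> chains K (Suc n)" "c' \<in> chains K (Suc n)" "b = boundary K c" "b' = boundary K c'"
    using assms unfolding boundaries_def by blast
  then have "b + b' = boundary K (c + c')" "c + c' \<in> chains K (Suc n)"
    using boundary_add chains_add by metis+
  then show ?thesis unfolding boundaries_def by (rule image_eqI)
qed

lemma boundaries_uminus:
  fixes b :: "'a list \<Rightarrow> 'f::field"
  assumes "b \<in> boundaries K n"
  shows "- b \<in> boundaries K n"
proof -
  obtain c where "c \<in> chains K (Suc n)" "b = boundary K c"
    using assms unfolding boundaries_def by blast
  then have "- b = boundary K (- c)" "- c \<in> chains K (Suc n)"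
    using boundary_uminus chains_uminus by metis+
  then show ?thesis unfolding boundaries_def by (rule image_eqI)
qed

lemma coset_boundaries:
  fixes b :: "'a list \<Rightarrow> 'f::field"
  assumes "b \<in> boundaries K n"
  shows "b +o boundaries K n = boundaries K n"
proof (intro set_eqI iffI)
  fix u assume "u \<in> b +o boundaries K n"
  then show "u \<in> boundaries K n"
    using assms boundaries_add by (auto simp: elt_set_plus_def)
next
  fix u :: "'a list \<Rightarrow> 'f" assume "u \<in> boundaries K n"
  then have "- b + u \<in> boundaries K n"
    using assms boundaries_add boundaries_uminus by blast
  then have "b + (- b + u) \<in> b +o boundaries K n" by (rule set_plus_intro2)
  then show "u \<in> b +o boundaries K n" by simp
qed

lemma cycles_zero: "(0 :: 'a list \<Rightarrow> 'f::field) \<in> cycles K n"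
  by (simp add: cycles_def chains_zero boundary_zero)

lemma homology_classes_trivial:
  assumes "(cycles K n :: ('a list \<Rightarrow> 'f::field) set) \<subseteq> boundaries K n"
  shows "homology_classes K n = {boundaries K n :: ('a list \<Rightarrow> 'f) set}"
proof -
  have "z +o boundaries K n = boundaries K n" if "z \<in> cycles K n" for z :: "'a list \<Rightarrow> 'f"
    using assms that by (intro coset_boundaries) blast
  moreover have "(cycles K n :: ('a list \<Rightarrow> 'f) set) \<noteq> {}" using cycles_zero by blast
  ultimately show ?thesis unfolding homology_classes_def by auto
qed

text \<open>A nonzero value at \<open>vs\<close> comes from some simplex \<open>x # vs\<close>,
  whose face \<open>vs\<close> lies in \<open>K\<close> by \<open>down\<close>. Antisymmetry passes
  to the boundary because swaps inside the tail of \<open>x # vs\<close> are swaps of that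
  list.\<close>

lemma boundary_chains:
  fixes c :: "'a list \<Rightarrow> 'f::field"
  assumes c: "c \<in> chains K (Suc n)"
    and down: "\<And>\<sigma> \<tau>. \<sigma> \<in> K \<Longrightarrow> \<tau> \<subseteq> \<sigma> \<Longrightarrow> \<tau> \<noteq> {} \<Longrightarrow> \<tau> \<in> K"
  shows "boundary K c \<in> chains K n"
  unfolding chains_def mem_Collect_eq
proof (intro conjI allI impI)
  fix vs assume "boundary K c vs \<noteq> 0"
  then obtain x where "c (x # vs) \<noteq> 0"
    unfolding boundary_def by (metis (no_types, lifting) sum.not_neutral_contains_not_neutral)
  then have vs: "length (x # vs) = n + 2" "distinct (x # vs)" "set (x # vs) \<in> K"
    using c unfolding chains_def by auto
  then have "set vs \<noteq> {}" by auto
  then show "length vs = n + 1" "distinct vs" "set vs \<in> K"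
    using vs down[OF vs(3), of "set vs"] by auto
next
  fix us ws :: "'a list" and x y
  have "c (p # us @ [x, y] @ ws) = - c (p # us @ [y, x] @ ws)" for p
    using c unfolding chains_def mem_Collect_eq by (metis append_Cons)
  then show "boundary K c (us @ [x, y] @ ws) = - boundary K c (us @ [y, x] @ ws)"
    by (simp only: boundary_def sum_negf)
qed

section \<open>One-chains as antisymmetric functions on ordered pairs\<close>

lemma chains_1_swap:
  fixes z :: "'a list \<Rightarrow> 'f::field"
  assumes "z \<in> chains K 1"
  shows "z [x, y] = - z [y, x]"
  using assms unfolding chains_def mem_Collect_eq by (metis append_Nil append_Nil2)

lemma chains_1_support:
  fixes z :: "'a list \<Rightarrow> 'f::field"
  assumes "z \<in> chains K 1" "z [x, y] \<noteq> 0"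
  shows "x \<noteq> y" "{x, y} \<in> K"
  using assms unfolding chains_def by fastforce+

lemma chains_1_eqI:
  fixes z z' :: "'a list \<Rightarrow> 'f::field"
  assumes "z \<in> chains K 1" "z' \<in> chains K 1" "\<And>x y. z [x, y] = z' [x, y]"
  shows "z = z'"
proof
  fix vs
  show "z vs = z' vs"
  proof (cases "length vs = 2")
    case True
    then obtain x y where "vs = [x, y]" by (auto simp: length_Suc_conv numeral_2_eq_2)
    then show ?thesis using assms by simp
  next
    case False
    then have "z vs = 0" "z' vs = 0" using assms unfolding chains_def by auto
    then show ?thesis by simp
  qed
qed

section \<open>Vanishing of the first homology\<close>

text \<open>\<open>\<Sum>\<^sub>x f x [w, v, x]\<close>: for \<open>f x = z [v, x]\<close> its boundary pushes the edges of \<open>z\<close> at \<open>v\<close> over to \<open>w\<close>.\<close>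

definition cone_chain :: "'a \<Rightarrow> 'a \<Rightarrow> ('a \<Rightarrow> 'f::field) \<Rightarrow> 'a list \<Rightarrow> 'f" where
  "cone_chain w v f vs = (case vs of [x, y, u] \<Rightarrow>
       (if x = w \<and> y = v then f u else 0) - (if x = v \<and> y = w then f u else 0)
     + (if y = w \<and> u = v then f x else 0) - (if y = v \<and> u = w then f x else 0)
     + (if u = w \<and> x = v then f y else 0) - (if u = v \<and> x = w then f y else 0)
   | _ \<Rightarrow> 0)"

lemma cone_chain_length:
  "length vs \<noteq> 3 \<Longrightarrow> cone_chain w v f vs = 0"
  unfolding cone_chain_def
  by (split list.split, intro conjI impI allI HOL.refl)+ simp

text \<open>The six terms are the six orderings of \<open>w, v, x\<close> with their signs. That
  \<open>f\<close> vanishes at \<open>w\<close> and \<open>v\<close> removes the degenerate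
  lists.\<close>

lemma cone_chain_chains:
  fixes f :: "'a \<Rightarrow> 'f::field"
  assumes "w \<noteq> v" "f w = 0" "f v = 0"
    and K: "\<And>x. f x \<noteq> 0 \<Longrightarrow> {w, v, x} \<in> K"
  shows "cone_chain w v f \<in> chains K 2"
  unfolding chains_def mem_Collect_eq
proof (intro conjI allI)
  fix vs :: "'a list"
  show "cone_chain w v f vs \<noteq> 0 \<longrightarrow> length vs = 2 + 1 \<and> distinct vs \<and> set vs \<in> K"
  proof
    assume nz: "cone_chain w v f vs \<noteq> 0"
    then have "length vs = 3" using cone_chain_length[of vs w v f] by auto
    then obtain x y u where vs: "vs = [x, y, u]" by (auto simp: length_Suc_conv numeral_3_eq_3)
    have good: "length vs = 2 + 1 \<and> distinct vs \<and> set vs \<in> K"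
      if "f p \<noteq> 0" "mset vs = {#w, v, p#}" for p
    proof -
      have "distinct [w, v, p]" using assms that by auto
      then have "distinct vs" using that(2) by (metis mset_eq_imp_distinct_iff mset.simps)
      moreover have "set vs = {w, v, p}" using that(2) by (metis set_mset_mset set_mset_add_mset_insert set_mset_empty)
      ultimately show ?thesis using K[OF that(1)] vs by simp
    qed
    \<comment> \<open>If \<open>vs\<close> is not a simplex, \<open>good\<close> forces each of the
      six terms to vanish, since the condition of each term fixes the multiset of
      \<open>vs\<close>.\<close>
    show "length vs = 2 + 1 \<and> distinct vs \<and> set vs \<in> K"
    proof (rule ccontr)
      assume "\<not> ?thesis"
      then have bad: "mset vs = {#w, v, p#} \<Longrightarrow> f p = 0" for p using good by blast
      have "(if x = w \<and> y = v then f u else 0) = 0" "(if x = v \<and> y = w then f u else 0) = 0"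
        using bad[of u] vs by (auto simp: add_mset_commute)
      moreover have "(if y = w \<and> u = v then f x else 0) = 0" "(if y = v \<and> u = w then f x else 0) = 0"
        using bad[of x] vs by (auto simp: add_mset_commute)
      moreover have "(if u = w \<and> x = v then f y else 0) = 0" "(if u = v \<and> x = w then f y else 0) = 0"
        using bad[of y] vs by (auto simp: add_mset_commute)
      ultimately have "cone_chain w v f vs = 0"
        unfolding vs cone_chain_def by (simp only: list.case) simp
      then show False using nz by blast
    qed
  qed
next
  fix us ws :: "'a list" and x y
  show "cone_chain w v f (us @ [x, y] @ ws) = - cone_chain w v f (us @ [y, x] @ ws)"
  proof (cases "length us + length ws = 1")
    case False
    then show ?thesis by (simp add: cone_chain_length)
  next
    case True
    then consider p where "us = [p]" "ws = []" | p where "us = []" "ws = [p]"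
      by (cases us; cases ws) auto
    then show ?thesis
      by cases (simp_all add: cone_chain_def conj_commute split del: if_split)
  qed
qed

text \<open>This is the coefficient form of \<open>[v, x] - [w, x] + [w, v]\<close>, weighted by
  \<open>f x\<close> and summed over \<open>x\<close>. Both orders of each edge appear, hence six
  terms.\<close>

lemma boundary_cone_chain:
  fixes f :: "'a \<Rightarrow> 'f::field"
  assumes "finite (\<Union>K)" "w \<in> \<Union>K" "v \<in> \<Union>K"
  shows "boundary K (cone_chain w v f) [y, u] =
      (if y = v then f u else 0) - (if y = w then f u else 0)
    + (if y = w \<and> u = v then sum f (\<Union>K) else 0) - (if y = v \<and> u = w then sum f (\<Union>K) else 0)
    + (if u = w then f y else 0) - (if u = v then f y else 0)"
proof -
  have 1: "(\<Sum>x\<in>\<Union>K. if x = p \<and> P then g else 0) = (if P then g else 0)"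
    if "p \<in> \<Union>K" for p P and g :: 'f
    using assms(1) that by (cases P) (simp_all add: sum.delta)
  have 2: "(\<Sum>x\<in>\<Union>K. if P \<and> x = p then g else 0) = (if P then g else 0)"
    if "p \<in> \<Union>K" for p P and g :: 'f
    using assms(1) that by (cases P) (simp_all add: sum.delta)
  have 3: "(\<Sum>x\<in>\<Union>K. if P then f x else 0) = (if P then sum f (\<Union>K) else 0)" for P
    by simp
  show ?thesis
    unfolding boundary_def cone_chain_def
    by (simp only: list.case sum.distrib sum_subtractf 1[OF assms(2)] 1[OF assms(3)]
        2[OF assms(2)] 2[OF assms(3)] 3)
qed

text \<open>Suppose no vertex is isolated or dominated. For an edge \<open>v w\<close>, some
  neighbour \<open>x\<close> of \<open>v\<close> is not adjacent to \<open>w\<close>, and some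
  neighbour \<open>y\<close> of \<open>w\<close> is not adjacent to \<open>v\<close>; these four
  exhaust \<open>W\<close>. As \<open>v\<close> does not dominate \<open>x\<close>, the vertex
  \<open>x\<close> must be adjacent to \<open>y\<close>, and \<open>v, w, y, x\<close> is a cycle
  without diagonals.\<close>

lemma exists_dominated_vertex:
  assumes "finite W" "card W \<le> 4" "W \<noteq> {}"
    and symE: "\<And>x y. E x y \<Longrightarrow> E y x"
    and irr: "\<And>x. \<not> E x x"
    and no_cycle: "\<And>a b c e. {a, b, c, e} \<subseteq> W \<Longrightarrow> E a b \<Longrightarrow> E b c \<Longrightarrow> E c e \<Longrightarrow> E e a \<Longrightarrow>
      a \<noteq> c \<Longrightarrow> b \<noteq> e \<Longrightarrow> E a c \<or> E b e"
  shows "\<exists>v\<in>W. (\<forall>x\<in>W. \<not> E v x) \<or> (\<exists>w\<in>W. E v w \<and> (\<forall>x\<in>W. E v x \<longrightarrow> x = w \<or> E w x))"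
proof (rule ccontr)
  assume neg: "\<not> ?thesis"
  then have notiso: "\<exists>w\<in>W. E v w" if "v \<in> W" for v using that by blast
  from neg have notdom: "\<exists>x\<in>W. E v x \<and> x \<noteq> w \<and> \<not> E w x" if "v \<in> W" "w \<in> W" "E v w" for v w
    using that by blast
  obtain v where v: "v \<in> W" using assms(3) by blast
  obtain w where w: "w \<in> W" "E v w" using notiso[OF v] by blast
  obtain x where x: "x \<in> W" "E v x" "x \<noteq> w" "\<not> E w x" using notdom v w by blast
  obtain y where y: "y \<in> W" "E w y" "y \<noteq> v" "\<not> E v y" using notdom[of w v] v w symE by blast
  have dist: "distinct [v, w, x, y]" using v w x y irr by auto
  have sub: "{v, w, x, y} \<subseteq> W" using v w x y by auto
  have "card {v, w, x, y} = 4" using dist by simp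
  then have W: "W = {v, w, x, y}" using card_seteq[OF assms(1) sub] assms(2) by simp
  obtain u where u: "u \<in> W" "E x u" "u \<noteq> v" "\<not> E v u" using notdom[of x v] v x symE by blast
  then have "u = y" using W w x irr by blast
  then show False
    using no_cycle[of v w y x] sub u v w x y symE by blast
qed

text \<open>The properties of a distance that enter the topological part; plane, sphere and
  hyperbolic plane are instances.\<close>

locale dissimilarity =
  fixes X :: "'a set" and d :: "'a \<Rightarrow> 'a \<Rightarrow> real"
  assumes nonneg: "\<And>x y. x \<in> X \<Longrightarrow> y \<in> X \<Longrightarrow> 0 \<le> d x y"
    and refl: "\<And>x. x \<in> X \<Longrightarrow> d x x = 0"
    and sym: "\<And>x y. x \<in> X \<Longrightarrow> y \<in> X \<Longrightarrow> d x y = d y x"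
begin

lemma Union_VR:
  assumes "finite Y" "Y \<subseteq> X" "0 \<le> r"
  shows "\<Union>(VR d Y r) = Y"
proof
  show "\<Union>(VR d Y r) \<subseteq> Y" by (auto simp: mem_VR[OF assms(1)])
  show "Y \<subseteq> \<Union>(VR d Y r)"
  proof
    fix x assume "x \<in> Y"
    then have "{x} \<in> VR d Y r" using assms refl by (auto simp: mem_VR)
    then show "x \<in> \<Union>(VR d Y r)" by blast
  qed
qed

lemma pair_mem_VR:
  assumes "finite Y" "Y \<subseteq> X" "0 \<le> r"
  shows "{x, y} \<in> VR d Y r \<longleftrightarrow> x \<in> Y \<and> y \<in> Y \<and> d x y \<le> r"
  using assms refl sym by (auto simp: mem_VR subset_iff)

text \<open>Induction on the size of a set \<open>W\<close> supporting the edges of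
  \<open>z\<close>. An isolated vertex of \<open>W\<close> carries no edge; at a dominated vertex
  \<open>v\<close> the boundary of a cone removes every edge. Either way \<open>v\<close> leaves the
  support.\<close>

lemma cycles_subset_boundaries:
  assumes Y: "finite Y" "Y \<subseteq> X" "0 \<le> r" "card Y \<le> 4"
    and no_cycle: "\<And>a b c e. {a, b, c, e} \<subseteq> Y \<Longrightarrow> distinct [a, b, c, e] \<Longrightarrow>
      d a b \<le> r \<Longrightarrow> d b c \<le> r \<Longrightarrow> d c e \<le> r \<Longrightarrow> d e a \<le> r \<Longrightarrow> d a c \<le> r \<or> d b e \<le> r"
  shows "(cycles (VR d Y r) 1 :: ('a list \<Rightarrow> 'f::field) set) \<subseteq> boundaries (VR d Y r) 1"
proof -
  let ?K = "VR d Y r"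
  define E where "E x y \<longleftrightarrow> x \<in> Y \<and> y \<in> Y \<and> x \<noteq> y \<and> d x y \<le> r" for x y
  have Esym: "E y x" if "E x y" for x y
    using that sym Y(2) by (auto simp: E_def subset_iff)
  have down: "\<tau> \<in> ?K" if "\<sigma> \<in> ?K" "\<tau> \<subseteq> \<sigma>" "\<tau> \<noteq> {}" for \<sigma> \<tau>
    using that Y(1) by (auto simp: mem_VR)
  \<comment> \<open>Only the support \<open>W\<close> shrinks; cycles and boundaries are always
    taken in the full complex.\<close>
  have "z \<in> boundaries ?K 1"
    if "W \<subseteq> Y" "z \<in> cycles ?K 1" "\<And>x y. z [x, y] \<noteq> 0 \<Longrightarrow> x \<in> W \<and> y \<in> W"
    for W and z :: "'a list \<Rightarrow> 'f"
    using that
  proof (induction "card W" arbitrary: W z)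
    case 0
    then have W: "W = {}" using Y(1) finite_subset by (metis card_0_eq)
    have "z = 0"
      by (rule chains_1_eqI[where K = ?K])
        (use 0 W in \<open>auto simp: cycles_def chains_zero\<close>)
    then show ?case using boundaries_zero by metis
  next
    case (Suc n)
    have finW: "finite W" using Suc.prems Y(1) finite_subset by blast
    have zc: "z \<in> chains ?K 1" and zb: "boundary ?K z = 0"
      using Suc.prems(2) by (auto simp: cycles_def)
    have zE: "E x y" if "z [x, y] \<noteq> 0" for x y
      using chains_1_support[OF zc that] pair_mem_VR[OF Y(1-3)] by (auto simp: E_def)
    \<comment> \<open>The cycle condition at \<open>[v]\<close> sums the edges into
      \<open>v\<close>; antisymmetry turns this into the sum of the edges out of
      \<open>v\<close>.\<close>
    have zcyc: "(\<Sum>x\<in>Y. z [v, x]) = 0" for v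
    proof -
      have "(\<Sum>x\<in>Y. z [x, v]) = 0"
        using fun_cong[OF zb, of "[v]"] Union_VR[OF Y(1-3)] by (simp add: boundary_def)
      then have "(\<Sum>x\<in>Y. - z [v, x]) = 0"
        by (subst (asm) sum.cong[OF HOL.refl chains_1_swap[OF zc]])
      then show ?thesis by (simp add: sum_negf)
    qed
    have "\<exists>v\<in>W. (\<forall>x\<in>W. \<not> E v x) \<or> (\<exists>w\<in>W. E v w \<and> (\<forall>x\<in>W. E v x \<longrightarrow> x = w \<or> E w x))"
    proof (rule exists_dominated_vertex[OF finW])
      show "card W \<le> 4" using card_mono[OF Y(1) Suc.prems(1)] Y(4) by simp
      show "W \<noteq> {}" using Suc.hyps(2) by auto
      show "E a c \<or> E b e"
        if "{a, b, c, e} \<subseteq> W" "E a b" "E b c" "E c e" "E e a" "a \<noteq> c" "b \<noteq> e" for a b c e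
        using that no_cycle[of a b c e] Suc.prems(1) by (auto simp: E_def)
    qed (simp_all add: Esym, simp add: E_def)
    then obtain v where v: "v \<in> W"
      and vcase: "(\<forall>x\<in>W. \<not> E v x) \<or> (\<exists>w\<in>W. E v w \<and> (\<forall>x\<in>W. E v x \<longrightarrow> x = w \<or> E w x))"
      by blast
    have cardW: "n = card (W - {v})" using v finW Suc.hyps(2) by simp
    from vcase show ?case
    proof
      assume iso: "\<forall>x\<in>W. \<not> E v x"
      show ?thesis
      proof (rule Suc.hyps(1)[OF cardW])
        show "x \<in> W - {v} \<and> y \<in> W - {v}" if "z [x, y] \<noteq> 0" for x y
          using iso Suc.prems(3)[OF that] zE[OF that] Esym by blast
      qed (use Suc.prems in auto)
    next
      assume "\<exists>w\<in>W. E v w \<and> (\<forall>x\<in>W. E v x \<longrightarrow> x = w \<or> E w x)"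
      then obtain w where w: "w \<in> W" "E v w" and dom: "\<And>x. x \<in> W \<Longrightarrow> E v x \<Longrightarrow> x = w \<or> E w x"
        by blast
      \<comment> \<open>The edge \<open>v w\<close> is left out because it spans no triangle with
        \<open>w\<close>. Its coefficient is recovered from the cycle condition.\<close>
      define f where "f x = (if x = w then 0 else z [v, x])" for x
      define g where "g = cone_chain w v f"
      have vw: "w \<noteq> v" "w \<in> Y" "v \<in> Y" using w by (auto simp: E_def)
      have zvv: "z [v, v] = 0" using chains_1_support(1)[OF zc, of v v] by blast
      have fE: "E v x \<and> E w x" if "f x \<noteq> 0" for x
        using that zE[of v x] Suc.prems(3)[of v x] dom[of x] by (auto simp: f_def split: if_splits)
      have gc: "g \<in> chains ?K (Suc 1)"
        unfolding g_def numeral_2_eq_2[symmetric] One_nat_def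
      proof (rule cone_chain_chains[OF vw(1)])
        show "{w, v, x} \<in> ?K" if "f x \<noteq> 0" for x
        proof -
          have "E v x" "E w x" "E x v" "E x w" "E w v" "E v w"
            using fE[OF that] w(2) Esym by auto
          then have e: "d v x \<le> r" "d w x \<le> r" "d x v \<le> r" "d x w \<le> r" "d w v \<le> r" "d v w \<le> r"
             "x \<in> Y" by (auto simp: E_def)
          have "d x x = 0" "d v v = 0" "d w w = 0" using refl e(7) vw Y(2) by auto
          then show ?thesis using e vw Y(1,3) by (simp add: mem_VR)
        qed
      qed (use zvv in \<open>auto simp: f_def\<close>)
      let ?S = "sum f Y"
      have bg: "boundary ?K g [y, u] =
            (if y = v then f u else 0) - (if y = w then f u else 0)
          + (if y = w \<and> u = v then ?S else 0) - (if y = v \<and> u = w then ?S else 0)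
          + (if u = w then f y else 0) - (if u = v then f y else 0)" for y u
        using boundary_cone_chain[of ?K w v f y u] vw Y(1) unfolding g_def Union_VR[OF Y(1-3)]
        by blast
      have bgc: "boundary ?K g \<in> chains ?K 1" by (rule boundary_chains[OF gc down])
      define z' where "z' = z + - boundary ?K g"
      have z'c: "z' \<in> chains ?K 1"
        unfolding z'_def by (intro chains_add chains_uminus zc bgc)
      \<comment> \<open>The identity that the boundary of a boundary is zero is checked for this
        cone alone, from the formula \<open>bg\<close>.\<close>
      have bb: "boundary ?K (boundary ?K g) = 0"
      proof
        fix vs
        show "boundary ?K (boundary ?K g) vs = 0 vs"
        proof (cases "length vs = 1")
          case False
          then have "boundary ?K g (x # vs) = 0" for x
            using bgc unfolding chains_def by fastforce
          then show ?thesis by (simp add: boundary_def[of ?K "boundary ?K g"])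
        next
          case True
          then obtain u where vs: "vs = [u]" by (auto simp: length_Suc_conv)
          have 1: "(\<Sum>y\<in>Y. if y = p \<and> P then h else 0) = (if P then h else 0)"
            if "p \<in> Y" for p P and h :: 'f
            using Y(1) that by (cases P) (simp_all add: sum.delta)
          have 2: "(\<Sum>y\<in>Y. if y = p then h else 0) = h" if "p \<in> Y" for p and h :: 'f
            using Y(1) that by (simp add: sum.delta)
          have 3: "(\<Sum>y\<in>Y. if P then f y else 0) = (if P then ?S else 0)" for P
            by simp
          have "boundary ?K (boundary ?K g) [u] = (\<Sum>y\<in>Y. boundary ?K g [y, u])"
            by (simp add: boundary_def[of ?K "boundary ?K g"] Union_VR[OF Y(1-3)])
          also have "\<dots> = 0"
            unfolding bg sum.distrib sum_subtractf 1[OF vw(2)] 1[OF vw(3)] 2[OF vw(2)] 2[OF vw(3)] 3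
            by simp
          finally show ?thesis unfolding vs by simp
        qed
      qed
      have z'b: "boundary ?K z' = 0"
        unfolding z'_def boundary_add boundary_uminus zb bb by simp
      \<comment> \<open>The edges at \<open>v\<close> sum to zero, so the weight of
        \<open>v w\<close> is minus the total of the others. This is the value of
        \<open>boundary ?K g\<close> at \<open>[v, w]\<close>, hence \<open>z'\<close> has no edge
        at \<open>v\<close>.\<close>
      have S: "z [v, w] + ?S = 0"
      proof -
        have "sum f Y = sum f (Y - {w})"
          using Y(1) by (intro sum.mono_neutral_right) (auto simp: f_def)
        also have "\<dots> = (\<Sum>x\<in>Y - {w}. z [v, x])" by (intro sum.cong) (auto simp: f_def)
        finally show ?thesis using sum.remove[OF Y(1) vw(2), of "\<lambda>x. z [v, x]"] zcyc[of v] by simp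
      qed
      have z'v: "z' [v, x] = 0" for x
      proof -
        have "boundary ?K g [v, x] = z [v, x]"
        proof (cases "x = w")
          case True
          have "?S = - z [v, w]" using S by (simp add: add_eq_0_iff)
          then show ?thesis using True vw zvv unfolding bg by (simp add: f_def)
        next
          case False
          then show ?thesis using vw zvv unfolding bg by (simp add: f_def)
        qed
        then show ?thesis by (simp add: z'_def)
      qed
      \<comment> \<open>Every edge in the boundary of \<open>g\<close> joins vertices among
        \<open>v\<close>, \<open>w\<close> and the support of \<open>f\<close>, all of which lie in
        \<open>W\<close>.\<close>
      have z'W: "x \<in> W - {v} \<and> y \<in> W - {v}" if nz: "z' [x, y] \<noteq> 0" for x y
      proof -
        have "x \<noteq> v" using z'v nz by auto
        moreover have "y \<noteq> v" using z'v nz chains_1_swap[OF z'c, of x y] by auto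
        moreover have "x \<in> W \<and> y \<in> W"
        proof (cases "z [x, y] = 0")
          case False
          then show ?thesis using Suc.prems(3) by blast
        next
          case True
          then have "boundary ?K g [x, y] \<noteq> 0" using nz by (simp add: z'_def)
          then have "x \<in> {v, w} \<and> f y \<noteq> 0 \<or> y \<in> {v, w} \<and> f x \<noteq> 0 \<or> x \<in> {v,w} \<and> y \<in> {v, w}"
            unfolding bg by (auto split: if_splits)
          moreover have "p \<in> W" if "f p \<noteq> 0" for p
            using that Suc.prems(3)[of v p] by (auto simp: f_def split: if_splits)
          ultimately show ?thesis using v w by auto
        qed
        ultimately show ?thesis by blast
      qed
      have "z' \<in> boundaries ?K 1"
        by (rule Suc.hyps(1)[OF cardW _ _ z'W]) (use Suc.prems z'c z'b in \<open>auto simp: cycles_def\<close>)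
      moreover have "boundary ?K g \<in> boundaries ?K 1"
        unfolding boundaries_def using gc by blast
      ultimately have "z' + boundary ?K g \<in> boundaries ?K 1" by (rule boundaries_add)
      then show ?thesis by (simp add: z'_def)
    qed
  qed
  moreover have "x \<in> Y \<and> y \<in> Y" if "z \<in> cycles ?K 1" "z [x, y] \<noteq> 0"
    for z :: "'a list \<Rightarrow> 'f" and x y
    using that chains_1_support(2)[of z ?K x y] pair_mem_VR[OF Y(1-3)] by (auto simp: cycles_def)
  ultimately show ?thesis by blast
qed

end

section \<open>Persistence of a four-cycle\<close>

text \<open>The multiple by \<open>t\<close> of the fundamental cycle of an oriented quadrilateral.
  Both orders of each edge are listed because chains are antisymmetric.\<close>

definition cycle_chain :: "'a \<Rightarrow> 'a \<Rightarrow> 'a \<Rightarrow> 'a \<Rightarrow> 'f::field \<Rightarrow> 'a list \<Rightarrow> 'f" where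
  "cycle_chain a b c e t vs =
     (if vs \<in> {[a, b], [b, c], [c, e], [e, a]} then t
      else if vs \<in> {[b, a], [c, b], [e, c], [a, e]} then - t else 0)"

lemma pspace_interval_sum:
  "pspace (interval_sum [(s, t)] :: ('f::field, nat \<Rightarrow> 'f) pmodule) r =
    (if s \<le> r \<and> r < t then {x. \<forall>i. x i \<noteq> 0 \<longrightarrow> i = 0} else {0})"
  by (auto simp: interval_sum_def fun_eq_iff cong: conj_cong)

lemma pspace_interval_sum_nontrivial:
  "(\<exists>x\<in>pspace (interval_sum [(s, t)] :: ('f::field, nat \<Rightarrow> 'f) pmodule) r.
      \<exists>y\<in>pspace (interval_sum [(s, t)] :: ('f, nat \<Rightarrow> 'f) pmodule) r. x \<noteq> y) \<longleftrightarrow> s \<le> r \<and> r < t"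
proof (cases "s \<le> r \<and> r < t")
  case True
  define u :: "nat \<Rightarrow> 'f" where "u i = (if i = 0 then 1 else 0)" for i
  have "u \<noteq> 0" by (auto simp: u_def fun_eq_iff intro: exI[of _ 0])
  moreover have "u \<in> pspace (interval_sum [(s, t)]) r" "0 \<in> pspace (interval_sum [(s, t)] :: ('f, nat \<Rightarrow> 'f) pmodule) r"
    using True by (auto simp: pspace_interval_sum u_def)
  ultimately show ?thesis using True by blast
next
  case False
  then show ?thesis unfolding pspace_interval_sum by auto
qed

text \<open>An isomorphism is bijective at each index, so it preserves whether a space has two
  distinct elements. Thus the interval can be read off from the module.\<close>

lemma pmodule_iso_interval_nontrivial:
  fixes V :: "('f::field, 'v) pmodule"
  assumes "pmodule_iso V (interval_sum [(s, t)])" "0 \<le> r"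
  shows "(\<exists>x\<in>pspace V r. \<exists>y\<in>pspace V r. x \<noteq> y) \<longleftrightarrow> s \<le> r \<and> r < t"
proof -
  let ?W = "interval_sum [(s, t)] :: ('f, nat \<Rightarrow> 'f) pmodule"
  obtain \<phi> where "bij_betw (\<phi> r) (pspace V r) (pspace ?W r)"
    using assms unfolding pmodule_iso_def by blast
  then have "inj_on (\<phi> r) (pspace V r)" "pspace ?W r = \<phi> r ` pspace V r"
    by (auto simp: bij_betw_def)
  then have "(\<exists>x\<in>pspace V r. \<exists>y\<in>pspace V r. x \<noteq> y) \<longleftrightarrow> (\<exists>x\<in>pspace ?W r. \<exists>y\<in>pspace ?W r. x \<noteq> y)"
    by (auto simp: inj_on_eq_iff)
  also have "\<dots> \<longleftrightarrow> s \<le> r \<and> r < t" by (rule pspace_interval_sum_nontrivial)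
  finally show ?thesis .
qed

context dissimilarity
begin

context
  fixes a b c e :: 'a and S D :: real
  assumes X: "{a, b, c, e} \<subseteq> X"
    and S: "S = max (max (d a b) (d b c)) (max (d c e) (d e a))"
    and D: "D = min (d a c) (d b e)"
    and SD: "S < D"
begin

text \<open>Identifying adjacent vertices would make a side equal to a diagonal, and identifying
  opposite ones would make a diagonal zero. Both contradict \<open>S < D\<close>.\<close>

lemma vertices_distinct: "distinct [a, b, c, e]"
proof -
  have eqs: "0 \<le> d a b" "d a a = 0" "d b b = 0" "d c e = d e c" "d e a = d a e"
    using X nonneg refl sym by blast+
  have "d a b \<le> S" "d b c \<le> S" "d e c \<le> S" "d a e \<le> S" "D \<le> d a c" "D \<le> d b e" "0 \<le> S"
    using eqs unfolding S D by auto
  then have "d a b < d a c" "d b c < d a c" "d e c < d a c" "d a e < d a c" "d b b < d b e"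
    "d a e < d b e" "d e c < d b e" "d a a < d a c" "d c e < d b e"
    using SD eqs by linarith+
  then show ?thesis by auto
qed

lemma side_nonneg: "0 \<le> S"
proof -
  have "0 \<le> d a b" using X nonneg by blast
  then show ?thesis using S by simp
qed

text \<open>Three of the four vertices always include a diagonal pair, so below \<open>D\<close>
  there is no triangle and no nonzero 2-chain.\<close>

lemma boundaries_eq_zero:
  assumes "r < D"
  shows "boundaries (VR d {a, b, c, e} r) 1 = {0 :: 'a list \<Rightarrow> 'f::field}"
proof -
  let ?K = "VR d {a, b, c, e} r"
  have "g = 0" if g: "g \<in> chains ?K 2" for g :: "'a list \<Rightarrow> 'f"
  proof
    fix vs
    show "g vs = 0 vs"
    proof (rule ccontr)
      assume "g vs \<noteq> 0 vs"
      then have vs: "length vs = 3" "distinct vs" "set vs \<in> ?K"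
        using g unfolding chains_def by auto
      then have card: "card (set vs) = 3" using distinct_card by fastforce
      have sub: "set vs \<subseteq> {a, b, c, e}" and le: "\<And>x y. x \<in> set vs \<Longrightarrow> y \<in> set vs \<Longrightarrow> d x y \<le> r"
        using vs(3) by (auto simp: mem_VR)
      have "\<not> (a \<in> set vs \<and> c \<in> set vs)" "\<not> (b \<in> set vs \<and> e \<in> set vs)"
        using le[of a c] le[of b e] assms D by auto
      \<comment> \<open>At most one vertex is taken from each diagonal.\<close>
      then obtain p q where "set vs \<subseteq> {p, q}"
        using sub that[of "if a \<in> set vs then a else c" "if b \<in> set vs then b else e"] by auto
      then have "card (set vs) \<le> card {p, q}" by (intro card_mono) auto
      also have "\<dots> \<le> 2" by (simp add: card_insert_if)
      finally show False using card by simp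
    qed
  qed
  then have "chains ?K 2 = {0 :: 'a list \<Rightarrow> 'f}" using chains_zero by blast
  then have "chains ?K (Suc 1) = {0 :: 'a list \<Rightarrow> 'f}" by (simp add: numeral_2_eq_2)
  then show ?thesis by (simp only: boundaries_def image_insert image_empty boundary_zero)
qed

text \<open>A chordless four-cycle on four vertices has exactly two non-edges, namely its diagonals.
  Below \<open>S\<close> there are at least three pairs longer than \<open>r\<close>, and from
  \<open>D\<close> on (with all sides present) at most one.\<close>

lemma homology_trivial_outside:
  assumes "0 \<le> r" "\<not> (S \<le> r \<and> r < D)"
  shows "homology_classes (VR d {a, b, c, e} r) 1 =
    {boundaries (VR d {a, b, c, e} r) 1 :: ('a list \<Rightarrow> 'f::field) set}"
proof (rule homology_classes_trivial, rule cycles_subset_boundaries)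
  let ?Y = "{a, b, c, e}"
  show "card ?Y \<le> 4" by (simp add: card_insert_if)
  fix a' b' c' e'
  assume sub: "{a', b', c', e'} \<subseteq> ?Y" and dis: "distinct [a', b', c', e']"
    and le: "d a' b' \<le> r" "d b' c' \<le> r" "d c' e' \<le> r" "d e' a' \<le> r"
  show "d a' c' \<le> r \<or> d b' e' \<le> r"
  proof (rule ccontr)
    assume "\<not> ?thesis"
    then have gt: "r < d a' c'" "r < d b' e'" by auto
    have symY: "d x y = d y x" if "x \<in> ?Y" "y \<in> ?Y" for x y using that X sym by blast
    have reflY: "d x x = 0" if "x \<in> ?Y" for x using that X refl by blast
    have "card {a', b', c', e'} = 4" "card ?Y = 4" using dis vertices_distinct by simp_all
    then have Y: "?Y = {a', b', c', e'}" using card_subset_eq[OF _ sub] by simp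
    show False
    proof (cases "r < S")
      \<comment> \<open>Both diagonals and at least one side exceed \<open>r\<close>: three distinct
        pairs, against the two allowed by \<open>only\<close>.\<close>
      case True
      have only: "{x, y} = {a', c'} \<or> {x, y} = {b', e'}" if "x \<in> ?Y" "y \<in> ?Y" "r < d x y" for x y
      proof -
        have "d b' a' \<le> r" "d c' b' \<le> r" "d e' c' \<le> r" "d a' e' \<le> r"
          using le symY sub by auto
        moreover have "x \<noteq> y" using that reflY[of x] assms(1) by auto
        ultimately show ?thesis using that le unfolding Y by auto
      qed
      have "r < d a c" "r < d b e" using True SD D by auto
      then have "{a, c} = {a', c'} \<or> {a, c} = {b', e'}" "{b, e} = {a', c'} \<or> {b, e} = {b', e'}"
        using only by blast+
      moreover obtain p q where pq: "p \<in> {a, c}" "q \<in> {b, e}" "r < d p q"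
      proof -
        have "r < d a b \<or> r < d c b \<or> r < d c e \<or> r < d a e"
          using True S symY[of c b] symY[of e a] by (auto simp: less_max_iff_disj)
        then show ?thesis using that by blast
      qed
      moreover have "{p, q} = {a', c'} \<or> {p, q} = {b', e'}"
        using pq only[of p q] by blast
      moreover have "{a, c} \<noteq> {b, e}" "{a, c} \<noteq> {p, q}" "{b, e} \<noteq> {p, q}"
        using vertices_distinct pq(1,2) by (auto simp: doubleton_eq_iff)
      ultimately show False by metis
    next
      case False
      \<comment> \<open>All sides and one diagonal are at most \<open>r\<close>, which leaves a
        single pair \<open>P\<close> that may exceed it.\<close>
      then have le': "D \<le> r" "d a b \<le> r" "d b c \<le> r" "d c e \<le> r" "d e a \<le> r"
        using assms(2) S by auto
      then have "d b a \<le> r" "d c b \<le> r" "d e c \<le> r" "d a e \<le> r"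
          "d a a \<le> r" "d b b \<le> r" "d c c \<le> r" "d e e \<le> r"
        using symY reflY assms(1) by auto
      then have few: "\<forall>x\<in>?Y. \<forall>y\<in>?Y. d x y \<le> r \<or> {x, y} = {a, c} \<or> {x, y} = {b, e}"
        using le' by (simp add: doubleton_eq_iff)
      have "d a c \<le> r \<and> d c a \<le> r \<or> d b e \<le> r \<and> d e b \<le> r"
        using le'(1) D symY by (auto simp: min_le_iff_disj)
      then obtain P where P: "\<forall>x\<in>?Y. \<forall>y\<in>?Y. d x y \<le> r \<or> {x, y} = P"
      proof
        assume "d a c \<le> r \<and> d c a \<le> r"
        then have "{x, y} = {a, c} \<longrightarrow> d x y \<le> r" for x y by (auto simp: doubleton_eq_iff)
        then show ?thesis using few that[of "{b, e}"] by blast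
      next
        assume "d b e \<le> r \<and> d e b \<le> r"
        then have "{x, y} = {b, e} \<longrightarrow> d x y \<le> r" for x y by (auto simp: doubleton_eq_iff)
        then show ?thesis using few that[of "{a, c}"] by blast
      qed
      have "a' \<in> ?Y" "b' \<in> ?Y" "c' \<in> ?Y" "e' \<in> ?Y" using sub by auto
      then have "{a', c'} = P" "{b', e'} = P" using P gt by (meson not_le)+
      then show False using dis by auto
    qed
  qed
qed (use assms X in auto)

lemma cycle_chain_values:
  "cycle_chain a b c e t [a, b] = t" "cycle_chain a b c e t [b, a] = - t"
  "cycle_chain a b c e t [b, c] = t" "cycle_chain a b c e t [c, b] = - t"
  "cycle_chain a b c e t [c, e] = t" "cycle_chain a b c e t [e, c] = - t"
  "cycle_chain a b c e t [e, a] = t" "cycle_chain a b c e t [a, e] = - t"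
  "cycle_chain a b c e t [a, c] = 0" "cycle_chain a b c e t [c, a] = 0"
  "cycle_chain a b c e t [b, e] = 0" "cycle_chain a b c e t [e, b] = 0"
  "cycle_chain a b c e t [a, a] = 0" "cycle_chain a b c e t [b, b] = 0"
  "cycle_chain a b c e t [c, c] = 0" "cycle_chain a b c e t [e, e] = 0"
proof -
  have "a \<noteq> b" "b \<noteq> a" "a \<noteq> c" "c \<noteq> a" "a \<noteq> e" "e \<noteq> a" "b \<noteq> c" "c \<noteq> b" "b \<noteq> e" "e \<noteq> b" "c \<noteq> e" "e \<noteq> c"
    using vertices_distinct by auto
  note [simp] = this
  show "cycle_chain a b c e t [a, b] = t" "cycle_chain a b c e t [b, a] = - t"
    "cycle_chain a b c e t [b, c] = t" "cycle_chain a b c e t [c, b] = - t"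
    "cycle_chain a b c e t [c, e] = t" "cycle_chain a b c e t [e, c] = - t"
    "cycle_chain a b c e t [e, a] = t" "cycle_chain a b c e t [a, e] = - t"
    "cycle_chain a b c e t [a, c] = 0" "cycle_chain a b c e t [c, a] = 0"
    "cycle_chain a b c e t [b, e] = 0" "cycle_chain a b c e t [e, b] = 0"
    "cycle_chain a b c e t [a, a] = 0" "cycle_chain a b c e t [b, b] = 0"
    "cycle_chain a b c e t [c, c] = 0" "cycle_chain a b c e t [e, e] = 0"
    by (simp_all add: cycle_chain_def)
qed

text \<open>Between \<open>S\<close> and \<open>D\<close> the edges are exactly the four sides. The
  cycle condition at a vertex equates the coefficients of its two edges, so the value on
  \<open>[a, b]\<close> propagates around the quadrilateral.\<close>

lemma cycles_eq:
  assumes "S \<le> r" "r < D"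
  shows "cycles (VR d {a, b, c, e} r) 1 = range (cycle_chain a b c e :: 'f::field \<Rightarrow> _)"
proof (intro set_eqI iffI)
  let ?Y = "{a, b, c, e}" and ?K = "VR d {a, b, c, e} r"
  note dis = vertices_distinct
  have fin: "finite ?Y" by simp
  have r: "0 \<le> r" using side_nonneg assms by simp
  have edge: "{x, y} \<in> ?K \<longleftrightarrow> x \<in> ?Y \<and> y \<in> ?Y \<and> d x y \<le> r" for x y
    by (rule pair_mem_VR[OF fin X r])
  have Un: "\<Union>?K = ?Y" by (rule Union_VR[OF fin X r])
  have sides: "{a, b} \<in> ?K" "{b, c} \<in> ?K" "{c, e} \<in> ?K" "{e, a} \<in> ?K"
    using assms S unfolding edge by auto
  have diags: "{a, c} \<notin> ?K" "{b, e} \<notin> ?K" using assms D unfolding edge by auto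
  {
    fix t :: 'f
    let ?z = "cycle_chain a b c e t"
    have "?z \<in> chains ?K 1"
      unfolding chains_def mem_Collect_eq
    proof (intro conjI allI)
      fix vs show "?z vs \<noteq> 0 \<longrightarrow> length vs = 1 + 1 \<and> distinct vs \<and> set vs \<in> ?K"
      proof
        assume "?z vs \<noteq> 0"
        then have "vs \<in> {[a, b], [b, c], [c, e], [e, a]} \<union> {[b, a], [c, b], [e, c], [a, e]}"
          unfolding cycle_chain_def by (metis UnCI)
        then show "length vs = 1 + 1 \<and> distinct vs \<and> set vs \<in> ?K"
          using sides dis by (auto simp: insert_commute)
      qed
    next
      fix us ws x y
      show "?z (us @ [x, y] @ ws) = - ?z (us @ [y, x] @ ws)"
      proof (cases "us = [] \<and> ws = []")
        case True
        \<comment> \<open>The two orientations of the quadrilateral; reversing an edge exchanges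
          them.\<close>
        define A B where AB: "A = {[a, b], [b, c], [c, e], [e, a]}" "B = {[b, a], [c, b], [e, c], [a, e]}"
        have "[x, y] \<in> A \<longleftrightarrow> [y, x] \<in> B" "[y, x] \<in> A \<longleftrightarrow> [x, y] \<in> B"
          unfolding AB by auto
        moreover have "\<not> ([x, y] \<in> A \<and> [x, y] \<in> B)" using dis unfolding AB by auto
        moreover have "?z vs = (if vs \<in> A then t else if vs \<in> B then - t else 0)" for vs
          by (simp only: cycle_chain_def AB)
        ultimately show ?thesis using True by simp
      next
        case False
        then have "length (us @ [x, y] @ ws) \<noteq> 2" "length (us @ [y, x] @ ws) \<noteq> 2" by auto
        moreover have "?z vs = 0" if "length vs \<noteq> 2" for vs
          using that by (auto simp: cycle_chain_def)
        ultimately have "?z (us @ [x, y] @ ws) = 0" "?z (us @ [y, x] @ ws) = 0" by blast+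
        then show ?thesis by simp
      qed
    qed
    moreover have "boundary ?K ?z = 0"
    proof
      fix vs
      show "boundary ?K ?z vs = 0 vs"
      proof (cases "\<exists>y\<in>?Y. vs = [y]")
        case True
        then obtain y where y: "y \<in> ?Y" "vs = [y]" by blast
        have "boundary ?K ?z [y] = ?z [a, y] + ?z [b, y] + ?z [c, y] + ?z [e, y]"
          using dis by (simp add: boundary_def Un add.assoc)
        also have "\<dots> = 0" using y(1) dis by (auto simp: cycle_chain_values)
        finally show ?thesis using y(2) by simp
      next
        case False
        then have "?z (x # vs) = 0" for x by (auto simp: cycle_chain_def)
        then show ?thesis by (simp add: boundary_def)
      qed
    qed
    ultimately have "?z \<in> cycles ?K 1" by (simp add: cycles_def)
  }
  note cyc = this
  show "z \<in> cycles ?K 1" if "z \<in> range (cycle_chain a b c e :: 'f \<Rightarrow> _)" for z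
    using that cyc by blast
  fix z :: "'a list \<Rightarrow> 'f"
  assume "z \<in> cycles ?K 1"
  then have zc: "z \<in> chains ?K 1" and zb: "boundary ?K z = 0" by (auto simp: cycles_def)
  have out: "z [x, y] = 0" if "x = y \<or> {x, y} \<notin> ?K" for x y
    using chains_1_support[OF zc] that by blast
  note swap = chains_1_swap[OF zc]
  have zero: "z [a, c] = 0" "z [c, a] = 0" "z [b, e] = 0" "z [e, b] = 0" "z [x, x] = 0" for x
    using out diags by (auto simp: insert_commute)
  have sum0: "z [a, y] + z [b, y] + z [c, y] + z [e, y] = 0" for y
    using fun_cong[OF zb, of "[y]"] dis by (simp add: boundary_def Un add.assoc)
  \<comment> \<open>Cycle conditions at \<open>b\<close>, \<open>c\<close> and \<open>e\<close> in
    turn.\<close>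
  have "z [c, b] = - z [a, b]" using sum0[of b] by (simp add: zero add_eq_0_iff)
  then have bc: "z [b, c] = z [a, b]" unfolding swap[of b c] by simp
  have "z [e, c] = - z [b, c]" using sum0[of c] by (simp add: zero add_eq_0_iff)
  then have ce: "z [c, e] = z [b, c]" unfolding swap[of c e] by simp
  have "z [a, e] = - z [c, e]" using sum0[of e] by (simp add: zero add_eq_0_iff2)
  then have ea: "z [e, a] = z [c, e]" unfolding swap[of e a] by simp
  have "z = cycle_chain a b c e (z [a, b])"
  proof (rule chains_1_eqI[OF zc])
    show c: "cycle_chain a b c e (z [a, b]) \<in> chains ?K 1" using cyc by (auto simp: cycles_def)
    fix x y
    show "z [x, y] = cycle_chain a b c e (z [a, b]) [x, y]"
    proof (cases "x \<in> ?Y \<and> y \<in> ?Y")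
      case True
      have "z [b, a] = - z [a, b]" "z [c, b] = - z [a, b]" "z [e, c] = - z [a, b]" "z [a, e] = - z [a, b]"
        using swap bc ce ea by metis+
      then show ?thesis using True zero bc ce ea by (auto simp: cycle_chain_values)
    next
      case False
      then have "z [x, y] = 0" "cycle_chain a b c e (z [a, b]) [x, y] = 0"
        using chains_1_support(2)[OF zc] chains_1_support(2)[OF c] edge by blast+
      then show ?thesis by simp
    qed
  qed
  then show "z \<in> range (cycle_chain a b c e)" by blast
qed

text \<open>On the bar the homology is the line spanned by the quadrilateral, and the coefficient of
  \<open>[a, b]\<close> is a coordinate on it that the inclusions preserve.\<close>

lemma VR_module_four_cycle:
  "pmodule_iso (VR_module 1 d {a, b, c, e} :: ('f::field, ('a list \<Rightarrow> 'f) set) pmodule)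
     (interval_sum [(S, D)])"
proof -
  let ?K = "VR d {a, b, c, e}"
  let ?V = "VR_module 1 d {a, b, c, e} :: ('f, ('a list \<Rightarrow> 'f) set) pmodule"
  let ?W = "interval_sum [(S, D)] :: ('f, nat \<Rightarrow> 'f) pmodule"
  \<comment> \<open>For \<open>S \<le> r < D\<close> the only boundary is 0, so each class is a
    singleton and \<open>the_elem\<close> returns its cycle. Outside this range the map is
    zero.\<close>
  define \<phi> :: "real \<Rightarrow> ('a list \<Rightarrow> 'f) set \<Rightarrow> nat \<Rightarrow> 'f"
    where "\<phi> r A i = (if i = 0 \<and> S \<le> r \<and> r < D then the_elem A [a, b] else 0)" for r A i
  note cab = cycle_chain_values(1)
  have inside: "pspace ?V r = range (\<lambda>t. {cycle_chain a b c e t})" if "S \<le> r" "r < D" for r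
    using cycles_eq[OF that, where 'f = 'f] boundaries_eq_zero[OF that(2), where 'f = 'f]
    by (simp add: VR_module_def homology_classes_def image_image elt_set_plus_def)
  have outside: "pspace ?V r = {boundaries (?K r) 1}" if "0 \<le> r" "\<not> (S \<le> r \<and> r < D)" for r
    using homology_trivial_outside[OF that, where 'f = 'f] by (simp add: VR_module_def)
  have \<phi>0: "\<phi> r A = 0" if "\<not> (S \<le> r \<and> r < D)" for r A
    using that by (auto simp: \<phi>_def fun_eq_iff)
  have \<phi>1: "\<phi> r {z} = (\<lambda>i. if i = 0 then z [a, b] else 0)" if "S \<le> r" "r < D" for r z
    using that by (auto simp: \<phi>_def)
  show ?thesis
    unfolding pmodule_iso_def
  proof (intro exI[of _ \<phi>] conjI allI impI ballI)
    fix r :: real assume r: "0 \<le> r"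
    show "bij_betw (\<phi> r) (pspace ?V r) (pspace ?W r)"
    proof (cases "S \<le> r \<and> r < D")
      case True
      then show ?thesis
        unfolding inside[OF conjunct1[OF True] conjunct2[OF True]] pspace_interval_sum
        by (intro bij_betw_byWitness[where f' = "\<lambda>x. {cycle_chain a b c e (x 0)}"])
          (auto simp: \<phi>1 cab fun_eq_iff split: if_splits)
    next
      case False
      then show ?thesis
        unfolding outside[OF r False] pspace_interval_sum using False \<phi>0 by (auto simp: bij_betw_def)
    qed
  next
    fix r :: real and u v assume r: "0 \<le> r" and uv: "u \<in> pspace ?V r" "v \<in> pspace ?V r"
    show "\<phi> r (padd ?V r u v) = padd ?W r (\<phi> r u) (\<phi> r v)"
    proof (cases "S \<le> r \<and> r < D")
      case True
      then obtain s t where "u = {cycle_chain a b c e s}" "v = {cycle_chain a b c e t}"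
        using uv inside[of r] by auto
      then have "padd ?V r u v = {cycle_chain a b c e s + cycle_chain a b c e t}"
          "u = {cycle_chain a b c e s}" "v = {cycle_chain a b c e t}"
        by (auto simp: VR_module_def set_plus_def)
      then show ?thesis
        using True by (simp add: \<phi>1 interval_sum_def fun_eq_iff)
    next
      case False
      then show ?thesis by (simp add: \<phi>0 interval_sum_def)
    qed
  next
    fix r :: real and q v assume r: "0 \<le> r" and v: "v \<in> pspace ?V r"
    show "\<phi> r (psmult ?V r q v) = psmult ?W r q (\<phi> r v)"
    proof (cases "S \<le> r \<and> r < D")
      case True
      then obtain t where "v = {cycle_chain a b c e t}" using v inside[of r] by auto
      then show ?thesis
        using True boundaries_eq_zero[of r, where 'f = 'f]
        by (auto simp: VR_module_def interval_sum_def \<phi>1 fun_eq_iff)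
    next
      case False
      then show ?thesis by (simp add: \<phi>0 interval_sum_def fun_eq_iff)
    qed
  next
    fix r s :: real and v assume r: "0 \<le> r" and rs: "r \<le> s" and v: "v \<in> pspace ?V r"
    have map: "pmap ?W r s x = (if S \<le> r \<and> s < D then (\<lambda>i. if i = 0 then x 0 else 0) else 0)" for x
      using rs by (auto simp: interval_sum_def fun_eq_iff)
    show "\<phi> s (pmap ?V r s v) = pmap ?W r s (\<phi> r v)"
    proof (cases "S \<le> s \<and> s < D")
      case s: True
      \<comment> \<open>Since \<open>r \<le> s < D\<close>, there are no nonzero boundaries at
        \<open>r\<close> either, so \<open>v\<close> is a singleton. Before birth it is the zero
        class.\<close>
      have "\<exists>z. v = {z} \<and> (\<not> S \<le> r \<longrightarrow> z = 0)"
      proof (cases "S \<le> r")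
        case True
        then show ?thesis using v inside[of r] s rs by auto
      next
        case False
        then show ?thesis using v outside[OF r] boundaries_eq_zero[of r, where 'f = 'f] s rs by auto
      qed
      then obtain z where z: "v = {z}" "\<not> S \<le> r \<longrightarrow> z = 0" by blast
      have "pmap ?V r s v = {z}"
        using boundaries_eq_zero[of s, where 'f = 'f] s by (simp add: VR_module_def z(1))
      then show ?thesis
        unfolding map using z s rs by (auto simp: \<phi>1 fun_eq_iff)
    next
      case False
      then have "\<not> (S \<le> r \<and> s < D)" using rs by auto
      then have "pmap ?W r s (\<phi> r v) = 0" by (simp only: map if_False)
      then show ?thesis using \<phi>0[OF False] by simp
    qed
  qed
qed

end

section \<open>The persistence set in terms of sides and diagonals\<close>

text \<open>Nonzero homology at the birth index yields a chordless four-cycle, which uses up all the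
  points. Its own bar is known from \<open>VR_module_four_cycle\<close>, and two bars of one module
  agree.\<close>

theorem D_VR_4_1_eq:
  "D_VR_4_1 TYPE('f::field) X d = {(s, t). \<exists>a b c e. {a, b, c, e} \<subseteq> X \<and>
     s = max (max (d a b) (d b c)) (max (d c e) (d e a)) \<and> t = min (d a c) (d b e) \<and> s < t}"
proof (intro set_eqI iffI; clarify)
  fix s t
  assume "(s, t) \<in> D_VR_4_1 TYPE('f) X d"
  then obtain Y where Y: "Y \<subseteq> X" "finite Y" "card Y \<le> 4"
    and "has_diagram (VR_module 1 d Y :: ('f, ('a list \<Rightarrow> 'f) set) pmodule) {#(s, t)#}"
    by (auto simp: D_VR_4_1_def persistence_set_def dgm_VR_def)
  then have st: "0 \<le> s" "s < t"
    and iso: "pmodule_iso (VR_module 1 d Y :: ('f, ('a list \<Rightarrow> 'f) set) pmodule) (interval_sum [(s, t)])"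
    by (auto simp: has_diagram_def)
  let ?H = "\<lambda>r. pspace (VR_module 1 d Y :: ('f, ('a list \<Rightarrow> 'f) set) pmodule) r"
  have nt: "(\<exists>x\<in>?H r. \<exists>y\<in>?H r. x \<noteq> y) \<longleftrightarrow> s \<le> r \<and> r < t" if "0 \<le> r" for r
    by (rule pmodule_iso_interval_nontrivial[OF iso that])
  have "\<not> (cycles (VR d Y s) 1 :: ('a list \<Rightarrow> 'f) set) \<subseteq> boundaries (VR d Y s) 1"
  proof
    assume "(cycles (VR d Y s) 1 :: ('a list \<Rightarrow> 'f) set) \<subseteq> boundaries (VR d Y s) 1"
    then have "?H s = {boundaries (VR d Y s) 1}"
      by (simp add: VR_module_def homology_classes_trivial)
    then show False using nt[OF st(1)] st(2) by auto
  qed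
  then obtain a b c e where abce: "{a, b, c, e} \<subseteq> Y" "distinct [a, b, c, e]"
    "d a b \<le> s" "d b c \<le> s" "d c e \<le> s" "d e a \<le> s" "\<not> d a c \<le> s" "\<not> d b e \<le> s"
    using cycles_subset_boundaries[OF Y(2,1) st(1) Y(3), where 'f = 'f] by blast
  have "card {a, b, c, e} = 4" using abce(2) by simp
  then have Yeq: "Y = {a, b, c, e}" using card_seteq[OF Y(2) abce(1)] Y(3) by simp
  define S D where SD: "S = max (max (d a b) (d b c)) (max (d c e) (d e a))" "D = min (d a c) (d b e)"
  have lt: "S \<le> s" "s < D" using abce by (auto simp: SD)
  have X: "{a, b, c, e} \<subseteq> X" using abce(1) Y(1) by blast
  have S0: "0 \<le> S" using side_nonneg[OF X SD] lt by simp
  have iso': "pmodule_iso (VR_module 1 d Y :: ('f, ('a list \<Rightarrow> 'f) set) pmodule) (interval_sum [(S, D)])"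
    unfolding Yeq by (rule VR_module_four_cycle[OF X SD]) (use lt in simp)
  \<comment> \<open>The comparison holds at indices \<open>r \<ge> 0\<close> only, so it matters
    that \<open>s\<close> and \<open>S\<close> are nonnegative.\<close>
  have same: "S \<le> r \<and> r < D \<longleftrightarrow> s \<le> r \<and> r < t" if "0 \<le> r" for r
    using pmodule_iso_interval_nontrivial[OF iso' that] nt[OF that] by metis
  have "s = S" using same[OF S0] lt by auto
  moreover have "t = D" using same[of t] same[of D] st lt by force
  ultimately show "\<exists>a b c e. {a, b, c, e} \<subseteq> X \<and>
     s = max (max (d a b) (d b c)) (max (d c e) (d e a)) \<and> t = min (d a c) (d b e) \<and> s < t"
    using X st(2) SD by blast
next
  fix a b c e
  let ?S = "max (max (d a b) (d b c)) (max (d c e) (d e a))" and ?D = "min (d a c) (d b e)"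
  assume X: "{a, b, c, e} \<subseteq> X" and lt: "?S < ?D"
  have "pmodule_iso (VR_module 1 d {a, b, c, e} :: ('f, ('a list \<Rightarrow> 'f) set) pmodule)
      (interval_sum [(?S, ?D)])"
    by (rule VR_module_four_cycle[OF X HOL.refl HOL.refl lt])
  then have "dgm_VR TYPE('f) 1 d {a, b, c, e} {#(?S, ?D)#}"
    unfolding dgm_VR_def has_diagram_def using lt side_nonneg[OF X HOL.refl HOL.refl lt]
    by (intro exI[of _ "[(?S, ?D)]"]) auto
  moreover have "card {a, b, c, e} \<le> 4" by (simp add: card_insert_if)
  ultimately show "(?S, ?D) \<in> D_VR_4_1 TYPE('f) X d"
    unfolding D_VR_4_1_def persistence_set_def using X by blast
qed

end

section \<open>Quadrilaterals in the model spaces\<close>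

context dissimilarity
begin

lemma D_VR_4_1_D:
  assumes "(s, t) \<in> D_VR_4_1 TYPE('f::field) X d"
  obtains a b c e where "a \<in> X" "b \<in> X" "c \<in> X" "e \<in> X"
    "d a b \<le> s" "d b c \<le> s" "d c e \<le> s" "d e a \<le> s" "t \<le> d a c" "t \<le> d b e" "0 \<le> s" "s < t"
proof -
  obtain a b c e where abce: "{a, b, c, e} \<subseteq> X"
     "s = max (max (d a b) (d b c)) (max (d c e) (d e a))" "t = min (d a c) (d b e)" "s < t"
    using assms unfolding D_VR_4_1_eq by blast
  have "0 \<le> d a b" using abce(1) nonneg by blast
  then have "0 \<le> s" "d a b \<le> s" "d b c \<le> s" "d c e \<le> s" "d e a \<le> s" "t \<le> d a c" "t \<le> d b e"
    unfolding abce(2,3) by linarith+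
  then show ?thesis using abce(1,4) that[of a b c e] by blast
qed

text \<open>The form met by the witnesses below: equal diagonals, with \<open>a b\<close> a longest
  side.\<close>

lemma D_VR_4_1_I:
  assumes "a \<in> X" "b \<in> X" "c \<in> X" "e \<in> X"
    "d a b = s" "d b c \<le> s" "d c e \<le> s" "d e a \<le> s" "d a c = t" "d b e = t" "s < t"
  shows "(s, t) \<in> D_VR_4_1 TYPE('f::field) X d"
proof -
  have "{a, b, c, e} \<subseteq> X" "s = max (max (d a b) (d b c)) (max (d c e) (d e a))" "t = min (d a c) (d b e)"
    using assms by auto
  then show ?thesis unfolding D_VR_4_1_eq using assms(11) by blast
qed

end

text \<open>Expansion of the squared norm of \<open>a + c - b - e\<close>. In terms of distances,
  the squared diagonals sum to at most the squared sides.\<close>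

lemma inner_quadrilateral:
  fixes a b c e :: "'a::real_inner"
  shows "2 * (a \<bullet> b + b \<bullet> c + c \<bullet> e + e \<bullet> a) \<le> a \<bullet> a + b \<bullet> b + c \<bullet> c + e \<bullet> e + 2 * (a \<bullet> c) + 2 * (b \<bullet> e)"
proof -
  have "0 \<le> (a + c - b - e) \<bullet> (a + c - b - e)" by simp
  then show ?thesis by (simp add: inner_add_left inner_add_right inner_diff_left inner_diff_right inner_commute)
qed

section \<open>The Euclidean plane\<close>

lemma dist_square: "(dist x y)\<^sup>2 = x \<bullet> x + y \<bullet> y - 2 * (x \<bullet> y)" for x y :: "'a::real_inner"
  by (simp add: dist_norm power2_norm_eq_inner inner_diff_left inner_diff_right inner_commute)

theorem D_VR_4_1_plane:
  "D_VR_4_1 TYPE('f::field) (UNIV :: (real^2) set) dist = {(s, t). 0 \<le> s \<and> s < t \<and> t \<le> sqrt 2 * s}"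
proof -
  interpret dissimilarity "UNIV :: (real^2) set" dist
    by unfold_locales (auto simp: dist_commute)
  show ?thesis
  proof (intro set_eqI iffI; clarify)
    fix s t assume "(s, t) \<in> D_VR_4_1 TYPE('f) (UNIV :: (real^2) set) dist"
    then obtain a b c e :: "real^2" where le: "dist a b \<le> s" "dist b c \<le> s" "dist c e \<le> s" "dist e a \<le> s"
      and ge: "t \<le> dist a c" "t \<le> dist b e" and st: "0 \<le> s" "s < t"
      by (rule D_VR_4_1_D)
    have "(dist a b)\<^sup>2 \<le> s\<^sup>2" "(dist b c)\<^sup>2 \<le> s\<^sup>2" "(dist c e)\<^sup>2 \<le> s\<^sup>2" "(dist e a)\<^sup>2 \<le> s\<^sup>2"
      using le by (simp_all add: power_mono)
    moreover have "t\<^sup>2 \<le> (dist a c)\<^sup>2" "t\<^sup>2 \<le> (dist b e)\<^sup>2" using ge st by (simp_all add: power_mono)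
    ultimately have "t\<^sup>2 \<le> 2 * s\<^sup>2"
      using inner_quadrilateral[of a b c e] unfolding dist_square by argo
    then have "t\<^sup>2 \<le> (sqrt 2 * s)\<^sup>2" by (simp add: power_mult_distrib)
    then have "t \<le> sqrt 2 * s" by (rule power2_le_imp_le) (use st in simp)
    then show "0 \<le> s \<and> s < t \<and> t \<le> sqrt 2 * s" using st by blast
  next
    fix s t :: real assume st: "0 \<le> s" "s < t" "t \<le> sqrt 2 * s"
    \<comment> \<open>\<open>- u\<close> is the cosine of the angle, seen from the midpoint, that the longer side subtends\<close>
    define u where "u = 2 * s\<^sup>2 / t\<^sup>2 - 1"
    define w where "w = sqrt (1 - u\<^sup>2)"
    \<comment> \<open>Coordinates scaled to radius \<open>t / 2\<close> about the common midpoint.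
      The vertices are two pairs of antipodal points on this circle, so they form a
      rectangle.\<close>
    define P :: "real \<Rightarrow> real \<Rightarrow> real^2" where "P x y = vector [t / 2 * x, t / 2 * y]" for x y
    have t: "0 < t" using st by simp
    have "t\<^sup>2 \<le> (sqrt 2 * s)\<^sup>2" using st t by (intro power_mono) auto
    then have "t\<^sup>2 \<le> 2 * s\<^sup>2" by (simp add: power_mult_distrib)
    \<comment> \<open>The bound \<open>t \<le> sqrt 2 * s\<close> amounts to
      \<open>u \<ge> 0\<close>, which makes \<open>a b\<close> the longer side; \<open>s < t\<close>
      amounts to \<open>u < 1\<close>.\<close>
    then have u0: "0 \<le> u" using t by (simp add: u_def field_simps)
    have "s\<^sup>2 < t\<^sup>2" using st by (intro power_strict_mono) auto
    then have u1: "u < 1" using t by (simp add: u_def field_simps)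
    have "u\<^sup>2 \<le> 1" using u0 u1 by (simp add: power_le_one)
    then have w: "w\<^sup>2 = 1 - u\<^sup>2" by (simp add: w_def)
    have s: "s\<^sup>2 = (t / 2)\<^sup>2 * (2 + 2 * u)" using t by (simp add: u_def field_simps power2_eq_square)
    have d: "dist (P x y) (P x' y') = sqrt ((t / 2)\<^sup>2 * ((x - x')\<^sup>2 + (y - y')\<^sup>2))" for x y x' y'
      by (simp add: P_def dist_norm norm_eq_sqrt_inner inner_vec_def sum_2 power2_eq_square algebra_simps)
    have side: "sqrt ((t / 2)\<^sup>2 * (2 + 2 * u)) = s" using st(1) unfolding s[symmetric] by simp
    have "sqrt ((t / 2)\<^sup>2 * (2 - 2 * u)) \<le> sqrt ((t / 2)\<^sup>2 * (2 + 2 * u))"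
      using u0 by (intro real_sqrt_le_mono mult_left_mono) auto
    then have side': "sqrt ((t / 2)\<^sup>2 * (2 - 2 * u)) \<le> s" unfolding side .
    have diag: "sqrt ((t / 2)\<^sup>2 * 4) = t"
      using t by (simp add: real_sqrt_mult)
    have e: "(1 + u)\<^sup>2 + w\<^sup>2 = 2 + 2 * u" "(1 - u)\<^sup>2 + w\<^sup>2 = 2 - 2 * u" "(2 * u)\<^sup>2 + (2 * w)\<^sup>2 = 4"
      using w by (simp_all add: power2_sum power2_diff power_mult_distrib)
    have 1: "dist (P 1 0) (P (- u) w) = s" using e(1) side by (simp add: d)
    have 2: "dist (P (- u) w) (P (- 1) 0) \<le> s" using e(2) side' by (simp add: d)
    have "(-1 - u)\<^sup>2 = (1 + u)\<^sup>2" "(u - 1)\<^sup>2 = (1 - u)\<^sup>2" by (simp_all add: power2_eq_square algebra_simps)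
    then have 3: "dist (P (- 1) 0) (P u (- w)) \<le> s" and 4: "dist (P u (- w)) (P 1 0) \<le> s"
      using e side side' by (simp_all add: d)
    have 5: "dist (P 1 0) (P (- 1) 0) = t" using diag by (simp add: d)
    have "(- u - u)\<^sup>2 = (2 * u)\<^sup>2" "(w + w)\<^sup>2 = (2 * w)\<^sup>2" by (simp_all add: power2_eq_square algebra_simps)
    then have 6: "dist (P (- u) w) (P u (- w)) = t" using e(3) diag by (simp add: d)
    show "(s, t) \<in> D_VR_4_1 TYPE('f) (UNIV :: (real^2) set) dist"
      by (rule D_VR_4_1_I[OF UNIV_I UNIV_I UNIV_I UNIV_I 1 2 3 4 5 6 st(2)])
  qed
qed

section \<open>Spheres\<close>

text \<open>Cauchy-Schwarz puts \<open>\<kappa> * (x \<bullet> y)\<close> in the interval from -1 to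
  1, where \<open>cos\<close> undoes \<open>arccos\<close>.\<close>

lemma cos_sphere_dist:
  assumes "\<kappa> > 0" "x \<in> sphere_space \<kappa>" "y \<in> sphere_space \<kappa>"
  shows "cos (sqrt \<kappa> * sphere_dist \<kappa> x y) = \<kappa> * (x \<bullet> y)"
    and "0 \<le> sphere_dist \<kappa> x y" and "sqrt \<kappa> * sphere_dist \<kappa> x y \<le> pi"
proof -
  have "x \<bullet> x = 1 / \<kappa>" "y \<bullet> y = 1 / \<kappa>" using assms by (auto simp: sphere_space_def)
  then have "\<bar>x \<bullet> y\<bar> \<le> sqrt (1 / \<kappa>) * sqrt (1 / \<kappa>)"
    using Cauchy_Schwarz_ineq2[of x y] by (simp add: norm_eq_sqrt_inner)
  also have "\<dots> = 1 / \<kappa>" using assms(1) by simp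
  finally have "\<bar>\<kappa> * (x \<bullet> y)\<bar> \<le> 1" using assms(1) by (simp add: abs_mult field_simps)
  then have b: "- 1 \<le> \<kappa> * (x \<bullet> y)" "\<kappa> * (x \<bullet> y) \<le> 1" by auto
  have k: "sqrt \<kappa> * sphere_dist \<kappa> x y = arccos (\<kappa> * (x \<bullet> y))"
    using assms(1) by (simp add: sphere_dist_def)
  show "cos (sqrt \<kappa> * sphere_dist \<kappa> x y) = \<kappa> * (x \<bullet> y)" "sqrt \<kappa> * sphere_dist \<kappa> x y \<le> pi"
    unfolding k using b by (auto intro: arccos_ubound)
  show "0 \<le> sphere_dist \<kappa> x y"
    unfolding sphere_dist_def using assms(1) arccos_lbound[OF b] by simp
qed

lemma dissimilarity_sphere:
  assumes "\<kappa> > 0"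
  shows "dissimilarity (sphere_space \<kappa>) (sphere_dist \<kappa>)"
proof
  show "0 \<le> sphere_dist \<kappa> x y" if "x \<in> sphere_space \<kappa>" "y \<in> sphere_space \<kappa>" for x y
    by (rule cos_sphere_dist(2)[OF assms that])
  show "sphere_dist \<kappa> x x = 0" if "x \<in> sphere_space \<kappa>" for x
    using that assms by (simp add: sphere_dist_def sphere_space_def)
  show "sphere_dist \<kappa> x y = sphere_dist \<kappa> y x" for x y
    by (simp add: sphere_dist_def inner_commute)
qed

theorem D_VR_4_1_sphere:
  assumes \<kappa>: "\<kappa> > 0"
  shows "D_VR_4_1 TYPE('f::field) (sphere_space \<kappa>) (sphere_dist \<kappa>) =
    {(s, t). sin (sqrt \<kappa> / 2 * t) \<le> sqrt 2 * sin (sqrt \<kappa> / 2 * s) \<and> 0 < s \<and> s < t \<and> t \<le> pi / sqrt \<kappa>}"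
proof -
  interpret dissimilarity "sphere_space \<kappa>" "sphere_dist \<kappa>" by (rule dissimilarity_sphere[OF \<kappa>])
  define k where "k = sqrt \<kappa>"
  have k: "0 < k" using \<kappa> by (simp add: k_def)
  note cs = cos_sphere_dist[OF \<kappa>, folded k_def]
  \<comment> \<open>Translates between inner products, which are cosines of lengths, and the sines
    of half lengths in the claim.\<close>
  have half: "cos (k * x) = 1 - 2 * (sin (k / 2 * x))\<^sup>2" for x
    using cos_double_sin[of "k / 2 * x"] by simp
  show ?thesis
    unfolding k_def[symmetric]
  proof (intro set_eqI iffI; clarify)
    fix s t assume "(s, t) \<in> D_VR_4_1 TYPE('f) (sphere_space \<kappa>) (sphere_dist \<kappa>)"
    then obtain a b c e where X: "a \<in> sphere_space \<kappa>" "b \<in> sphere_space \<kappa>" "c \<in> sphere_space \<kappa>" "e \<in> sphere_space \<kappa>"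
      and le: "sphere_dist \<kappa> a b \<le> s" "sphere_dist \<kappa> b c \<le> s" "sphere_dist \<kappa> c e \<le> s" "sphere_dist \<kappa> e a \<le> s"
      and ge: "t \<le> sphere_dist \<kappa> a c" "t \<le> sphere_dist \<kappa> b e" and st: "0 \<le> s" "s < t"
      by (rule D_VR_4_1_D)
    have "k * t \<le> k * sphere_dist \<kappa> a c" using ge k by simp
    then have kt: "k * t \<le> pi" using cs(3)[OF X(1,3)] by linarith
    have ks: "k * s \<le> pi" using kt st k by (smt (verit) mult_strict_left_mono)
    \<comment> \<open>Cosine decreases on the interval from 0 to \<pi>, so short sides mean large
      inner products and long diagonals small ones.\<close>
    have side: "cos (k * s) \<le> \<kappa> * (x \<bullet> y)"
      if "x \<in> sphere_space \<kappa>" "y \<in> sphere_space \<kappa>" "sphere_dist \<kappa> x y \<le> s" for x y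
      unfolding cs(1)[OF that(1,2), symmetric]
      using cs(2)[OF that(1,2)] that(3) k ks by (intro cos_monotone_0_pi_le) auto
    have diag: "\<kappa> * (x \<bullet> y) \<le> cos (k * t)"
      if "x \<in> sphere_space \<kappa>" "y \<in> sphere_space \<kappa>" "t \<le> sphere_dist \<kappa> x y" for x y
      unfolding cs(1)[OF that(1,2), symmetric]
      using cs(3)[OF that(1,2)] that(3) k st by (intro cos_monotone_0_pi_le) auto
    have unit: "\<kappa> * (x \<bullet> x) = 1" if "x \<in> sphere_space \<kappa>" for x
      using that \<kappa> by (simp add: sphere_space_def)
    have "\<kappa> * (2 * (a \<bullet> b + b \<bullet> c + c \<bullet> e + e \<bullet> a)) \<le>
        \<kappa> * (a \<bullet> a + b \<bullet> b + c \<bullet> c + e \<bullet> e + 2 * (a \<bullet> c) + 2 * (b \<bullet> e))"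
      using \<kappa> inner_quadrilateral by (intro mult_left_mono) auto
    then have "2 * (\<kappa> * (a \<bullet> b) + \<kappa> * (b \<bullet> c) + \<kappa> * (c \<bullet> e) + \<kappa> * (e \<bullet> a)) \<le>
        4 + 2 * (\<kappa> * (a \<bullet> c)) + 2 * (\<kappa> * (b \<bullet> e))"
      using X by (simp add: unit algebra_simps)
    then have "2 * cos (k * s) \<le> 1 + cos (k * t)"
      using side[OF X(1,2) le(1)] side[OF X(2,3) le(2)] side[OF X(3,4) le(3)] side[OF X(4,1) le(4)]
        diag[OF X(1,3) ge(1)] diag[OF X(2,4) ge(2)] by argo
    then have "(sin (k / 2 * t))\<^sup>2 \<le> 2 * (sin (k / 2 * s))\<^sup>2" unfolding half by argo
    then have sq: "(sin (k / 2 * t))\<^sup>2 \<le> (sqrt 2 * sin (k / 2 * s))\<^sup>2" by (simp add: power_mult_distrib)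
    have "k * s \<le> pi * 2" using ks pi_gt_zero by linarith
    then have "0 \<le> sin (k / 2 * s)" using st k by (intro sin_ge_zero) auto
    then have le: "sin (k / 2 * t) \<le> sqrt 2 * sin (k / 2 * s)" by (intro power2_le_imp_le[OF sq]) simp
    have "k * t < pi * 2" using kt pi_gt_zero by linarith
    then have "0 < sin (k / 2 * t)" using st k by (intro sin_gt_zero) auto
    \<comment> \<open>At \<open>s = 0\<close> the bound would make a positive sine
      nonpositive.\<close>
    then have "s \<noteq> 0" using le by auto
    then show "sin (k / 2 * t) \<le> sqrt 2 * sin (k / 2 * s) \<and> 0 < s \<and> s < t \<and> t \<le> pi / k"
      using le st kt k by (auto simp: field_simps)
  next
    fix s t assume le: "sin (k / 2 * t) \<le> sqrt 2 * sin (k / 2 * s)" and st: "0 < s" "s < t" and "t \<le> pi / k"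
    then have kt: "k * t \<le> pi" using k by (simp add: field_simps)
    have ks: "k * s < k * t" using st k by simp
    \<comment> \<open>The diagonals cross at the pole \<open>P 1 0 0\<close>, at distance
      \<open>t / 2\<close> from every vertex. By the spherical law of cosines, \<open>- u\<close> is
      the cosine of the angle between \<open>a\<close> and \<open>b\<close> at the pole, and
      \<open>w\<close> is its sine.\<close>
    define C S where "C = cos (k / 2 * t)" and "S = sin (k / 2 * t)"
    define u where "u = (C\<^sup>2 - cos (k * s)) / S\<^sup>2"
    define w where "w = sqrt (1 - u\<^sup>2)"
    define P :: "real \<Rightarrow> real \<Rightarrow> real \<Rightarrow> real^3" where "P x y z = vector [x / k, y / k, z / k]" for x y z
    have "k * t < pi * 2" using kt pi_gt_zero by linarith
    then have S: "0 < S" unfolding S_def using st k by (intro sin_gt_zero) auto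
    have CS: "C\<^sup>2 + S\<^sup>2 = 1" by (simp add: C_def S_def)
    have "S\<^sup>2 \<le> (sqrt 2 * sin (k / 2 * s))\<^sup>2" using le S unfolding S_def by (intro power_mono) auto
    then have "cos (k * s) \<le> C\<^sup>2" using CS by (simp add: half power_mult_distrib)
    \<comment> \<open>As in the plane, the sine bound gives \<open>u \<ge> 0\<close> and
      \<open>s < t\<close> gives \<open>u < 1\<close>.\<close>
    then have u0: "0 \<le> u" using S by (simp add: u_def)
    have ckt: "cos (k * t) = C\<^sup>2 - S\<^sup>2" using cos_double[of "k / 2 * t"] by (simp add: C_def S_def)
    have "cos (k * t) < cos (k * s)" using ks kt st k by (intro cos_monotone_0_pi) auto
    then have u1: "u < 1" using S unfolding ckt by (simp add: u_def field_simps)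
    have "u\<^sup>2 \<le> 1" using u0 u1 by (simp add: power_le_one)
    then have w: "w\<^sup>2 = 1 - u\<^sup>2" by (simp add: w_def)
    have cks: "cos (k * s) = C\<^sup>2 - S\<^sup>2 * u" using S by (simp add: u_def)
    have inn: "\<kappa> * (P x y z \<bullet> P x' y' z') = x * x' + y * y' + z * z'" for x y z x' y' z'
    proof -
      have "P x y z \<bullet> P x' y' z' = (x * x' + y * y' + z * z') / \<kappa>"
        using \<kappa> by (simp add: P_def inner_vec_def sum_3 k_def add_divide_distrib)
      then show ?thesis using \<kappa> by simp
    qed
    have dist: "sphere_dist \<kappa> p q = r" if "\<kappa> * (p \<bullet> q) = cos (k * r)" "0 \<le> r" "k * r \<le> pi" for p q r
      using that k unfolding sphere_dist_def k_def[symmetric] by (simp add: arccos_cos)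
    have mem: "P x y z \<in> sphere_space \<kappa>" if "x\<^sup>2 + y\<^sup>2 + z\<^sup>2 = 1" for x y z
      using inn[of x y z x y z] that \<kappa> by (simp add: sphere_space_def power2_eq_square field_simps)
    have dist_le: "sphere_dist \<kappa> p q \<le> s"
      if "p \<in> sphere_space \<kappa>" "q \<in> sphere_space \<kappa>" "cos (k * s) \<le> \<kappa> * (p \<bullet> q)" for p q
    proof (rule ccontr)
      assume "\<not> ?thesis"
      then have "k * s < k * sphere_dist \<kappa> p q" using k by simp
      then have "cos (k * sphere_dist \<kappa> p q) < cos (k * s)"
        using cs(3)[OF that(1,2)] st k by (intro cos_monotone_0_pi) auto
      then show False using that cs(1) by simp
    qed
    \<comment> \<open>Opposite vertices are exchanged by the half turn about the pole, so both
      diagonals have length \<open>t\<close>.\<close>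
    let ?a = "P C S 0" and ?b = "P C (- S * u) (S * w)" and ?c = "P C (- S) 0" and ?e = "P C (S * u) (- S * w)"
    have Sw: "S * w * (S * w) = S\<^sup>2 - S * u * (S * u)"
    proof -
      have "S * w * (S * w) = S\<^sup>2 * w\<^sup>2" by (simp add: power2_eq_square)
      then show ?thesis unfolding w by (simp add: power2_eq_square algebra_simps)
    qed
    have X: "?a \<in> sphere_space \<kappa>" "?b \<in> sphere_space \<kappa>" "?c \<in> sphere_space \<kappa>" "?e \<in> sphere_space \<kappa>"
      using CS Sw by (auto intro!: mem simp: power2_eq_square)
    have pos: "0 \<le> S\<^sup>2 * u" using u0 by simp
    have 1: "sphere_dist \<kappa> ?a ?b = s"
      using cks st ks kt by (intro dist) (auto simp: inn power2_eq_square)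
    have 2: "sphere_dist \<kappa> ?b ?c \<le> s"
      by (rule dist_le[OF X(2,3)]) (use cks pos in \<open>simp add: inn power2_eq_square\<close>)
    have 3: "sphere_dist \<kappa> ?c ?e \<le> s"
      by (rule dist_le[OF X(3,4)]) (use cks pos in \<open>simp add: inn power2_eq_square\<close>)
    have 4: "sphere_dist \<kappa> ?e ?a \<le> s"
      by (rule dist_le[OF X(4,1)]) (use cks pos in \<open>simp add: inn power2_eq_square\<close>)
    have 5: "sphere_dist \<kappa> ?a ?c = t"
      using ckt st kt by (intro dist) (auto simp: inn power2_eq_square)
    have 6: "sphere_dist \<kappa> ?b ?e = t"
      using ckt st kt Sw by (intro dist) (auto simp: inn power2_eq_square)
    show "(s, t) \<in> D_VR_4_1 TYPE('f) (sphere_space \<kappa>) (sphere_dist \<kappa>)"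
      by (rule D_VR_4_1_I[OF X 1 2 3 4 5 6 st(2)])
  qed
qed

section \<open>Hyperbolic planes\<close>

text \<open>The common bound \<open>m\<close> covers both uses: points of \<open>hyp_space\<close>,
  with \<open>m = - 1 / \<kappa>\<close>, and the sums \<open>a + c\<close> and \<open>b + e\<close>
  of opposite vertices.\<close>

lemma lorentz_reverse_Cauchy_Schwarz:
  assumes "0 \<le> p $ 1" "0 \<le> q $ 1" "0 \<le> m" "m \<le> - lorentz p p" "m \<le> - lorentz q q"
  shows "m \<le> - lorentz p q"
proof -
  define x y x' y' where "x = p $ 2" "y = p $ 3" "x' = q $ 2" "y' = q $ 3"
  have p: "m + x\<^sup>2 + y\<^sup>2 \<le> (p $ 1)\<^sup>2" and q: "m + x'\<^sup>2 + y'\<^sup>2 \<le> (q $ 1)\<^sup>2"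
    using assms(4,5) by (auto simp: lorentz_def x_y_x'_y'_def power2_eq_square)
  \<comment> \<open>Lagrange's identity for the vectors \<open>(sqrt m, x, y)\<close> and
    \<open>(sqrt m, x', y')\<close>.\<close>
  have "(m + x * x' + y * y')\<^sup>2 + m * ((x - x')\<^sup>2 + (y - y')\<^sup>2) + (x * y' - y * x')\<^sup>2
      = (m + x\<^sup>2 + y\<^sup>2) * (m + x'\<^sup>2 + y'\<^sup>2)"
    by (simp add: power2_eq_square algebra_simps)
  moreover have "0 \<le> m * ((x - x')\<^sup>2 + (y - y')\<^sup>2)" using assms(3) by simp
  ultimately have "(m + x * x' + y * y')\<^sup>2 \<le> (m + x\<^sup>2 + y\<^sup>2) * (m + x'\<^sup>2 + y'\<^sup>2)"
    using zero_le_power2[of "x * y' - y * x'"] by linarith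
  also have "\<dots> \<le> (p $ 1)\<^sup>2 * (q $ 1)\<^sup>2" using p q assms(3) by (intro mult_mono) auto
  finally have "(m + x * x' + y * y')\<^sup>2 \<le> (p $ 1 * q $ 1)\<^sup>2" by (simp add: power_mult_distrib)
  then have "m + x * x' + y * y' \<le> p $ 1 * q $ 1" by (rule power2_le_imp_le) (use assms in simp)
  then show ?thesis by (simp add: lorentz_def x_y_x'_y'_def)
qed

lemma lorentz_commute: "lorentz x y = lorentz y x"
  by (simp add: lorentz_def algebra_simps)

text \<open>The reverse Cauchy-Schwarz inequality gives
  \<open>\<kappa> * lorentz x y \<ge> 1\<close>, the range where \<open>cosh\<close> undoes
  \<open>arcosh\<close>.\<close>

lemma cosh_hyp_dist:
  assumes "\<kappa> < 0" "x \<in> hyp_space \<kappa>" "y \<in> hyp_space \<kappa>"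
  shows "cosh (sqrt (- \<kappa>) * hyp_dist \<kappa> x y) = \<kappa> * lorentz x y" and "0 \<le> hyp_dist \<kappa> x y"
proof -
  have "0 \<le> x $ 1" "0 \<le> y $ 1" "0 \<le> - (1 / \<kappa>)"
    "- (1 / \<kappa>) \<le> - lorentz x x" "- (1 / \<kappa>) \<le> - lorentz y y"
    using assms by (simp_all add: hyp_space_def)
  then have "- (1 / \<kappa>) \<le> - lorentz x y" by (rule lorentz_reverse_Cauchy_Schwarz)
  then have "lorentz x y \<le> 1 / \<kappa>" by simp
  then have "\<kappa> * (1 / \<kappa>) \<le> \<kappa> * lorentz x y" using assms(1) by (intro mult_left_mono_neg) auto
  then have b: "1 \<le> \<kappa> * lorentz x y" using assms(1) by simp
  have k: "sqrt (- \<kappa>) * hyp_dist \<kappa> x y = arcosh (\<kappa> * lorentz x y)"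
    using assms(1) by (simp add: hyp_dist_def)
  show "cosh (sqrt (- \<kappa>) * hyp_dist \<kappa> x y) = \<kappa> * lorentz x y"
    unfolding k using b by (rule cosh_arcosh_real)
  show "0 \<le> hyp_dist \<kappa> x y"
    unfolding hyp_dist_def using assms(1) arcosh_nonneg_real[OF b] by simp
qed

lemma dissimilarity_hyp:
  assumes "\<kappa> < 0"
  shows "dissimilarity (hyp_space \<kappa>) (hyp_dist \<kappa>)"
proof
  show "0 \<le> hyp_dist \<kappa> x y" if "x \<in> hyp_space \<kappa>" "y \<in> hyp_space \<kappa>" for x y
    by (rule cosh_hyp_dist(2)[OF assms that])
  show "hyp_dist \<kappa> x x = 0" if "x \<in> hyp_space \<kappa>" for x
    using that assms by (simp add: hyp_dist_def hyp_space_def)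
  show "hyp_dist \<kappa> x y = hyp_dist \<kappa> y x" for x y
    by (simp add: hyp_dist_def lorentz_commute)
qed

theorem D_VR_4_1_hyp:
  assumes \<kappa>: "\<kappa> < 0"
  shows "D_VR_4_1 TYPE('f::field) (hyp_space \<kappa>) (hyp_dist \<kappa>) =
    {(s, t). sinh (sqrt (- \<kappa>) / 2 * t) \<le> sqrt 2 * sinh (sqrt (- \<kappa>) / 2 * s) \<and> 0 < s \<and> s < t}"
proof -
  interpret dissimilarity "hyp_space \<kappa>" "hyp_dist \<kappa>" by (rule dissimilarity_hyp[OF \<kappa>])
  define k where "k = sqrt (- \<kappa>)"
  have k: "0 < k" using \<kappa> by (simp add: k_def)
  note cs = cosh_hyp_dist[OF \<kappa>, folded k_def]
  have half: "cosh (k * x) = 1 + 2 * (sinh (k / 2 * x))\<^sup>2" for x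
    using cosh_double[of "k / 2 * x"] by (simp add: cosh_square_eq)
  show ?thesis
    unfolding k_def[symmetric]
  proof (intro set_eqI iffI; clarify)
    fix s t assume "(s, t) \<in> D_VR_4_1 TYPE('f) (hyp_space \<kappa>) (hyp_dist \<kappa>)"
    then obtain a b c e where X: "a \<in> hyp_space \<kappa>" "b \<in> hyp_space \<kappa>" "c \<in> hyp_space \<kappa>" "e \<in> hyp_space \<kappa>"
      and le: "hyp_dist \<kappa> a b \<le> s" "hyp_dist \<kappa> b c \<le> s" "hyp_dist \<kappa> c e \<le> s" "hyp_dist \<kappa> e a \<le> s"
      and ge: "t \<le> hyp_dist \<kappa> a c" "t \<le> hyp_dist \<kappa> b e" and st: "0 \<le> s" "s < t"
      by (rule D_VR_4_1_D)
    have side: "\<kappa> * lorentz x y \<le> cosh (k * s)"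
      if "x \<in> hyp_space \<kappa>" "y \<in> hyp_space \<kappa>" "hyp_dist \<kappa> x y \<le> s" for x y
      unfolding cs(1)[OF that(1,2), symmetric]
      using cs(2)[OF that(1,2)] that(3) k st by (simp add: cosh_real_nonneg_le_iff)
    have diag: "cosh (k * t) \<le> \<kappa> * lorentz x y"
      if "x \<in> hyp_space \<kappa>" "y \<in> hyp_space \<kappa>" "t \<le> hyp_dist \<kappa> x y" for x y
      unfolding cs(1)[OF that(1,2), symmetric]
      using cs(2)[OF that(1,2)] that(3) k st by (simp add: cosh_real_nonneg_le_iff)
    have unit: "\<kappa> * lorentz x x = 1" if "x \<in> hyp_space \<kappa>" for x
      using that \<kappa> by (simp add: hyp_space_def)
    have add: "\<kappa> * lorentz (x + y) (z + v) =
        \<kappa> * lorentz x z + \<kappa> * lorentz x v + \<kappa> * lorentz y z + \<kappa> * lorentz y v" for x y z v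
      by (simp add: lorentz_def algebra_simps)
    \<comment> \<open>The form multiplied by \<kappa> takes the value
      \<open>2 + 2 * (\<kappa> * lorentz a c)\<close> at \<open>a + c\<close>, and similarly at
      \<open>b + e\<close>; the diagonals bound both below by
      \<open>2 + 2 * cosh (k * t)\<close>.\<close>
    define m where "m = (2 + 2 * cosh (k * t)) / - \<kappa>"
    have m_le: "m \<le> - lorentz x y" if "2 + 2 * cosh (k * t) \<le> \<kappa> * lorentz x y" for x y
      unfolding m_def using that \<kappa> by (simp add: field_simps)
    have "m \<le> - lorentz (a + c) (b + e)"
    proof (rule lorentz_reverse_Cauchy_Schwarz)
      show "0 \<le> (a + c) $ 1" "0 \<le> (b + e) $ 1" using X by (auto simp: hyp_space_def)
      show "0 \<le> m" unfolding m_def using \<kappa> cosh_real_pos[of "k * t"] by (intro divide_nonneg_pos) auto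
      show "m \<le> - lorentz (a + c) (a + c)"
        using diag[OF X(1,3) ge(1)] X by (intro m_le) (simp add: add unit lorentz_commute[of c a])
      show "m \<le> - lorentz (b + e) (b + e)"
        using diag[OF X(2,4) ge(2)] X by (intro m_le) (simp add: add unit lorentz_commute[of e b])
    qed
    then have "2 + 2 * cosh (k * t) \<le> \<kappa> * lorentz (a + c) (b + e)"
      unfolding m_def using \<kappa> by (simp add: field_simps)
    \<comment> \<open>The mixed product of \<open>a + c\<close> and \<open>b + e\<close> is the sum
      over the four sides, each at most \<open>cosh (k * s)\<close>.\<close>
    then have "2 + 2 * cosh (k * t) \<le> 4 * cosh (k * s)"
      using side[OF X(1,2) le(1)] side[OF X(2,3) le(2)] side[OF X(3,4) le(3)] side[OF X(4,1) le(4)]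
      unfolding add lorentz_commute[of c b] lorentz_commute[of a e] by argo
    then have "(sinh (k / 2 * t))\<^sup>2 \<le> 2 * (sinh (k / 2 * s))\<^sup>2" unfolding half by argo
    then have sq: "(sinh (k / 2 * t))\<^sup>2 \<le> (sqrt 2 * sinh (k / 2 * s))\<^sup>2" by (simp add: power_mult_distrib)
    have "0 \<le> sinh (k / 2 * s)" using st k by simp
    then have le: "sinh (k / 2 * t) \<le> sqrt 2 * sinh (k / 2 * s)" by (intro power2_le_imp_le[OF sq]) simp
    have "0 < sinh (k / 2 * t)" using st k by simp
    then have "s \<noteq> 0" using le by auto
    then show "sinh (k / 2 * t) \<le> sqrt 2 * sinh (k / 2 * s) \<and> 0 < s \<and> s < t"
      using le st by auto
  next
    fix s t assume le: "sinh (k / 2 * t) \<le> sqrt 2 * sinh (k / 2 * s)" and st: "0 < s" "s < t"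
    \<comment> \<open>Polar coordinates about the midpoint \<open>P 1 0 0\<close> as on the sphere;
      \<open>u\<close> now comes from the hyperbolic law of cosines.\<close>
    define C S where "C = cosh (k / 2 * t)" and "S = sinh (k / 2 * t)"
    define u where "u = (cosh (k * s) - C\<^sup>2) / S\<^sup>2"
    define w where "w = sqrt (1 - u\<^sup>2)"
    define P :: "real \<Rightarrow> real \<Rightarrow> real \<Rightarrow> real^3" where "P x y z = vector [x / k, y / k, z / k]" for x y z
    have S: "0 < S" unfolding S_def using st k by simp
    have C: "0 < C" unfolding C_def by (rule cosh_real_pos)
    have CS: "C\<^sup>2 = S\<^sup>2 + 1" by (simp add: C_def S_def cosh_square_eq)
    have "S\<^sup>2 \<le> (sqrt 2 * sinh (k / 2 * s))\<^sup>2" using le S unfolding S_def by (intro power_mono) auto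
    then have "C\<^sup>2 \<le> cosh (k * s)" using CS by (simp add: half power_mult_distrib)
    then have u0: "0 \<le> u" using S by (simp add: u_def)
    have ckt: "cosh (k * t) = C\<^sup>2 + S\<^sup>2" using cosh_double[of "k / 2 * t"] by (simp add: C_def S_def)
    have "cosh (k * s) < cosh (k * t)" using st k by (simp add: cosh_real_nonneg_less_iff)
    then have u1: "u < 1" using S unfolding ckt by (simp add: u_def field_simps)
    have "u\<^sup>2 \<le> 1" using u0 u1 by (simp add: power_le_one)
    then have w: "w\<^sup>2 = 1 - u\<^sup>2" by (simp add: w_def)
    have cks: "cosh (k * s) = C\<^sup>2 + S\<^sup>2 * u" using S by (simp add: u_def)
    have inn: "\<kappa> * lorentz (P x y z) (P x' y' z') = x * x' - y * y' - z * z'" for x y z x' y' z'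
    proof -
      have "lorentz (P x y z) (P x' y' z') = (x * x' - y * y' - z * z') / \<kappa>"
        using \<kappa> by (simp add: P_def lorentz_def k_def add_divide_distrib diff_divide_distrib)
      then show ?thesis using \<kappa> by simp
    qed
    have dist: "hyp_dist \<kappa> p q = r" if "\<kappa> * lorentz p q = cosh (k * r)" "0 \<le> r" for p q r
      using that k unfolding hyp_dist_def k_def[symmetric] by (simp add: arcosh_cosh_real)
    have mem: "P x y z \<in> hyp_space \<kappa>" if "x\<^sup>2 - y\<^sup>2 - z\<^sup>2 = 1" "0 < x" for x y z
    proof -
      have "\<kappa> * lorentz (P x y z) (P x y z) = 1" using that by (simp add: inn power2_eq_square)
      then have "lorentz (P x y z) (P x y z) = 1 / \<kappa>" using \<kappa> by (simp add: field_simps)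
      then show ?thesis using that(2) k by (simp add: hyp_space_def P_def)
    qed
    have dist_le: "hyp_dist \<kappa> p q \<le> s"
      if "p \<in> hyp_space \<kappa>" "q \<in> hyp_space \<kappa>" "\<kappa> * lorentz p q \<le> cosh (k * s)" for p q
      using that(3) cs(2)[OF that(1,2)] st k unfolding cs(1)[OF that(1,2), symmetric]
      by (simp add: cosh_real_nonneg_le_iff)
    let ?a = "P C S 0" and ?b = "P C (- S * u) (S * w)" and ?c = "P C (- S) 0" and ?e = "P C (S * u) (- S * w)"
    have Sw: "S * w * (S * w) = S\<^sup>2 - S * u * (S * u)"
    proof -
      have "S * w * (S * w) = S\<^sup>2 * w\<^sup>2" by (simp add: power2_eq_square)
      then show ?thesis unfolding w by (simp add: power2_eq_square algebra_simps)
    qed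
    have X: "?a \<in> hyp_space \<kappa>" "?b \<in> hyp_space \<kappa>" "?c \<in> hyp_space \<kappa>" "?e \<in> hyp_space \<kappa>"
      using CS Sw C by (auto intro!: mem simp: power2_eq_square)
    have pos: "0 \<le> S\<^sup>2 * u" using u0 by simp
    have 1: "hyp_dist \<kappa> ?a ?b = s"
      using cks st by (intro dist) (auto simp: inn power2_eq_square)
    have 2: "hyp_dist \<kappa> ?b ?c \<le> s"
      by (rule dist_le[OF X(2,3)]) (use cks pos in \<open>simp add: inn power2_eq_square\<close>)
    have 3: "hyp_dist \<kappa> ?c ?e \<le> s"
      by (rule dist_le[OF X(3,4)]) (use cks pos in \<open>simp add: inn power2_eq_square\<close>)
    have 4: "hyp_dist \<kappa> ?e ?a \<le> s"
      by (rule dist_le[OF X(4,1)]) (use cks pos in \<open>simp add: inn power2_eq_square\<close>)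
    have 5: "hyp_dist \<kappa> ?a ?c = t"
      using ckt st by (intro dist) (auto simp: inn power2_eq_square)
    have 6: "hyp_dist \<kappa> ?b ?e = t"
      using ckt st Sw by (intro dist) (auto simp: inn power2_eq_square)
    show "(s, t) \<in> D_VR_4_1 TYPE('f) (hyp_space \<kappa>) (hyp_dist \<kappa>)"
      by (rule D_VR_4_1_I[OF X 1 2 3 4 5 6 st(2)])
  qed
qed

theorem theorem5p19:
  fixes \<kappa> :: real
  shows "(\<kappa> > 0 \<longrightarrow>
            D_VR_4_1 TYPE('f::field) (sphere_space \<kappa>) (sphere_dist \<kappa>) =
              {(t\<^sub>b, t\<^sub>d). sin (sqrt \<kappa> / 2 * t\<^sub>d) \<le> sqrt 2 * sin (sqrt \<kappa> / 2 * t\<^sub>b) \<and>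
                         0 < t\<^sub>b \<and> t\<^sub>b < t\<^sub>d \<and> t\<^sub>d \<le> pi / sqrt \<kappa>}) \<and>
         (\<kappa> = 0 \<longrightarrow>
            D_VR_4_1 TYPE('f) (UNIV :: (real^2) set) dist =
              {(t\<^sub>b, t\<^sub>d). 0 \<le> t\<^sub>b \<and> t\<^sub>b < t\<^sub>d \<and> t\<^sub>d \<le> sqrt 2 * t\<^sub>b}) \<and>
         (\<kappa> < 0 \<longrightarrow>
            D_VR_4_1 TYPE('f) (hyp_space \<kappa>) (hyp_dist \<kappa>) =
              {(t\<^sub>b, t\<^sub>d). sinh (sqrt (- \<kappa>) / 2 * t\<^sub>d) \<le> sqrt 2 * sinh (sqrt (- \<kappa>) / 2 * t\<^sub>b) \<and>
                         0 < t\<^sub>b \<and> t\<^sub>b < t\<^sub>d})"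
  by (simp add: D_VR_4_1_plane D_VR_4_1_sphere D_VR_4_1_hyp)

end
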